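(* Let $n,m,p,k\ge1$ be integers, let $\Omega=\{\omega_1,\dots,\omega_k\}$ be a set of basis input functions of the form described in the context, with $\ell_{\max}=\max\{\ell_1,\dots,\ell_k\}$, and let $\mathcal{C}_{m,p}$ be the sign system concept class with $p$-dimensional observations. Then $$\mathrm{VC}(\mathcal{C}_{m,p})\le 2(2pmn^2+4n+p)\log_2\Big[8e\big(8mn^2k(n+\ell_{\max})+1\big)\big(2^p-1+2p(2k+1)^n+2nk\big)\Big].$$
   Context: Basis input functions: $\omega_1,\dots,\omega_k:[0,1]\to\mathbb{R}$ are linearly independent, and for each $j$ either $\omega_j(t)=t^{\ell_j}e^{\alpha_j t}\sin(\beta_j t)$ or $\omega_j(t)=t^{\ell_j}e^{\alpha_j t}\cos(\beta_j t)$ with $\ell_j\in\{0,1,2,\dots\}$ and $\alpha_j,\beta_j\in\mathbb{R}$. Put $\omega=(\omega_1,\dots,\omega_k)^T$. Systems: a linear system $\Sigma=(A,B,C,x^0)$ of dimension $n$ with $m$ inputs and $p$ outputs is $\dot x=Ax+Bu$, $x(0)=x^0$, $y=Cx$ on $[0,1]$, with $A,B,C$ real matrices of sizes $n\times n$, $n\times m$, $p\times n$ and $x^0\in\mathbb{R}^n$. Let $X_\Omega=\{G\omega:[0,1]\to\mathbb{R}^m : G\in\mathbb{R}^{m\times k}\}$ and $S_\Sigma:X_\Omega\to\{0,1\}^p$, $S_\Sigma(G\omega)=(\mathrm{sign}\,y_1(1),\dots,\mathrm{sign}\,y_p(1))^T$, where $y(1)$ is the final output of $\Sigma$ under control $u=G\omega$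 and $\mathrm{sign}\,z=1$ if $z>0$, $\mathrm{sign}\,z=0$ if $z\le0$. The sign system concept class is $\mathcal{C}_{m,p}=\{S_\Sigma:\Sigma\text{ a linear system of dimension }n\}$. VC-dimension for $p$-dimensional observations: the $p$-dimensional output is regarded as the bits of a number in $\{0,\dots,2^p-1\}$, so that each $f\in\mathcal{C}_{m,p}$ is a map $X_\Omega\to\{0,\dots,2^p-1\}$. For each $f\in\mathcal{C}_{m,p}$ let $L_{0\text{-}1,f}(z,a)=1$ if $f(z)\ne a$ and $0$ otherwise, for $z\in X_\Omega$, $a\in\{0,\dots,2^p-1\}$. Then $\mathrm{VC}(\mathcal{C}_{m,p})$ is by definition the VC-dimension of the class $\{L_{0\text{-}1,f}:f\in\mathcal{C}_{m,p}\}$ of $\{0,1\}$-valued functions, i.e. the largest cardinality of a set $D$ of pairs $(z,a)$ such that every map $D\to\{0,1\}$ is the restriction of some $L_{0\text{-}1,f}$. *)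

theory Defs
  imports
    Complex_Main
    "HOL-Library.FuncSet"
    "HOL-Library.Extended_Real"
    "Jordan_Normal_Form.Matrix"
begin

section \<open>Basis input functions\<close>

definition basis_input :: "nat \<Rightarrow> real \<Rightarrow> real \<Rightarrow> (real \<Rightarrow> real) \<Rightarrow> bool" where
  "basis_input l \<alpha> \<beta> w \<longleftrightarrow>
     (\<forall>t\<in>{0..1}. w t = t ^ l * exp (\<alpha> * t) * sin (\<beta> * t)) \<or>
     (\<forall>t\<in>{0..1}. w t = t ^ l * exp (\<alpha> * t) * cos (\<beta> * t))"

definition lin_indep_on_unit :: "nat \<Rightarrow> (nat \<Rightarrow> real \<Rightarrow> real) \<Rightarrow> bool" where
  "lin_indep_on_unit k \<omega> \<longleftrightarrow>
     (\<forall>c :: nat \<Rightarrow> real. (\<forall>t\<in>{0..1}. (\<Sum>j<k. c j * \<omega> j t) = 0) \<longrightarrow> (\<forall>j<k. c j = 0))"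

text \<open>Inputs are functions on the unit interval, represented as extensional functions.\<close>

definition input_space :: "nat \<Rightarrow> nat \<Rightarrow> (nat \<Rightarrow> real \<Rightarrow> real) \<Rightarrow> (real \<Rightarrow> real vec) set" where
  "input_space m k \<omega> =
     {(\<lambda>t\<in>{0..1}. G *\<^sub>v vec k (\<lambda>j. \<omega> j t)) | G. G \<in> carrier_mat m k}"


section \<open>Linear systems and their sign outputs\<close>

datatype linear_system =
  Linear_System (sys_A: "real mat") (sys_B: "real mat") (sys_C: "real mat") (sys_x0: "real vec")

definition linear_systems :: "nat \<Rightarrow> nat \<Rightarrow> nat \<Rightarrow> linear_system set" where
  "linear_systems n m p =
     {\<Sigma>. sys_A \<Sigma> \<in> carrier_mat n n \<and> sys_B \<Sigma> \<in> carrier_mat n m \<and>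
         sys_C \<Sigma> \<in> carrier_mat p n \<and> sys_x0 \<Sigma> \<in> carrier_vec n}"

text \<open>The type of vectors carries no topology, so the differential equation is stated
  componentwise; at the endpoints of the interval the derivative is one-sided.\<close>

definition is_trajectory ::
    "linear_system \<Rightarrow> (real \<Rightarrow> real vec) \<Rightarrow> (real \<Rightarrow> real vec) \<Rightarrow> bool" where
  "is_trajectory \<Sigma> u x \<longleftrightarrow>
     x 0 = sys_x0 \<Sigma> \<and>
     (\<forall>t\<in>{0..1}. x t \<in> carrier_vec (dim_row (sys_A \<Sigma>)) \<and>
       (\<forall>i<dim_row (sys_A \<Sigma>).
          ((\<lambda>s. x s $ i) has_real_derivative (sys_A \<Sigma> *\<^sub>v x t + sys_B \<Sigma> *\<^sub>v u t) $ i)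
            (at t within {0..1})))"

definition final_output :: "linear_system \<Rightarrow> (real \<Rightarrow> real vec) \<Rightarrow> real vec" where
  "final_output \<Sigma> u = sys_C \<Sigma> *\<^sub>v (THE v. \<exists>x. is_trajectory \<Sigma> u x \<and> v = x 1)"

text \<open>Not the library function \<^const>\<open>sgn\<close>: negative numbers are sent to 0.\<close>

definition sign01 :: "real \<Rightarrow> nat" where
  "sign01 z = (if z > 0 then 1 else 0)"

definition sign_output :: "linear_system \<Rightarrow> (real \<Rightarrow> real vec) \<Rightarrow> nat vec" where
  "sign_output \<Sigma> u = map_vec sign01 (final_output \<Sigma> u)"

definition bits_to_nat :: "nat vec \<Rightarrow> nat" where
  "bits_to_nat v = (\<Sum>i<dim_vec v. v $ i * 2 ^ i)"

definition sign_system_class ::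
    "nat \<Rightarrow> nat \<Rightarrow> nat \<Rightarrow> nat \<Rightarrow> (nat \<Rightarrow> real \<Rightarrow> real) \<Rightarrow> ((real \<Rightarrow> real vec) \<Rightarrow> nat) set" where
  "sign_system_class n m p k \<omega> =
     (\<lambda>\<Sigma>. \<lambda>u\<in>input_space m k \<omega>. bits_to_nat (sign_output \<Sigma> u)) ` linear_systems n m p"


section \<open>VC-dimension\<close>

definition shatters :: "('a \<Rightarrow> nat) set \<Rightarrow> 'a set \<Rightarrow> bool" where
  "shatters H D \<longleftrightarrow>
     (\<forall>g. (\<forall>d\<in>D. g d \<in> {0, 1}) \<longrightarrow> (\<exists>h\<in>H. \<forall>d\<in>D. h d = g d))"

text \<open>\<open>H\<close> is a class of \<open>{0, 1}\<close>-valued functions on \<open>Z\<close>. The dimension is infinite if some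
  infinite set, or finite sets of unbounded size, are shattered.\<close>

definition vc_dim :: "'a set \<Rightarrow> ('a \<Rightarrow> nat) set \<Rightarrow> enat" where
  "vc_dim Z H =
     (SUP D\<in>{D. D \<subseteq> Z \<and> shatters H D}. if finite D then enat (card D) else \<infinity>)"

definition loss01 :: "('z \<Rightarrow> nat) \<Rightarrow> 'z \<times> nat \<Rightarrow> nat" where
  "loss01 f = (\<lambda>(z, a). if f z \<noteq> a then 1 else 0)"

definition vc_sign_systems ::
    "nat \<Rightarrow> nat \<Rightarrow> nat \<Rightarrow> nat \<Rightarrow> (nat \<Rightarrow> real \<Rightarrow> real) \<Rightarrow> enat" where
  "vc_sign_systems n m p k \<omega> =
     vc_dim (input_space m k \<omega> \<times> {0..<2 ^ p}) (loss01 ` sign_system_class n m p k \<omega>)"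

end

theory Submission
  imports
    Defs
    "HOL-Analysis.Function_Topology"
    "HOL-Analysis.Henstock_Kurzweil_Integration"
    "Jordan_Normal_Form.Char_Poly"
begin

text \<open>
  A shattered set of \<open>N\<close> pairs forces \<open>2\<^sup>N\<close> different sign patterns of the \<open>p\<close> outputs on at most
  \<open>N\<close> inputs.  The proof writes these outputs as polynomials in few parameters of the system, bounds
  the number of sign patterns of polynomials, and compares the two numbers.

  \<^emph>\<open>Polynomial outputs.\<close>  Every basis input is \<open>Re (\<kappa> t\<^sup>l e\<^sup>\<mu>\<^sup>t)\<close>.  With \<open>E t = e\<^sup>t\<^sup>A\<close>, put
  \<open>K\<^sub>l = \<integral>\<^sub>0\<^sup>1 E (1 - s) s\<^sup>l e\<^sup>\<mu>\<^sup>s ds\<close>.  Integration by parts gives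
  \<open>K\<^sub>l (A - \<mu>) = l K\<^sub>l\<^sub>-\<^sub>1 - e\<^sup>\<mu> + [l = 0] E 1\<close>, and multiplying by the adjugate of \<open>A - \<mu>\<close> gives
  \<open>det (A - \<mu>)\<^sup>l\<^sup>+\<^sup>1 K\<^sub>l = E 1 U\<^sub>l + V\<^sub>l\<close> with \<open>U\<^sub>l\<close> and \<open>V\<^sub>l\<close> polynomial in the entries of \<open>A\<close>
  (\<open>response_mat_closed_form\<close>).  Hence the final output, multiplied by the positive number
  \<open>\<Prod>\<^sub>q \<bar>det (A - \<mu>\<^sub>q)\<^sup>l\<^sup>+\<^sup>1\<bar>\<^sup>2\<close>, is a polynomial in the entries of \<open>A\<close>, \<open>B\<close>, \<open>C\<close>, \<open>H = C (E 1)\<close> and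
  of the vector \<open>C (E 1) x\<^sub>0\<close>, which are treated as \<open>n\<^sup>2 + n m + 2 p n + p\<close> independent parameters.
  Replacing \<open>A\<close> by \<open>A + \<epsilon>\<close> and lowering the constant term slightly removes singular matrices and
  outputs that are exactly zero, without changing the pattern on finitely many inputs
  (\<open>sign_sample\<close>).

  \<^emph>\<open>Sign patterns.\<close>  \<open>M\<close> polynomials of degree at most \<open>D\<close> in \<open>d\<close> variables have at most
  \<open>(2 M D + 1)\<^sup>d\<close> sign patterns without zeros (\<open>card_sign_cells_le\<close>).  Let \<open>g\<close> be the square of their
  product and let \<open>\<phi> = g - \<epsilon> \<Sum>\<^sub>i x\<^sub>i\<^sup>2\<^sup>M\<^sup>D\<^sup>+\<^sup>2\<close>.  For small \<open>\<epsilon>\<close> the function \<open>\<phi>\<close> is positive somewhere in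
  each cell, it is at most \<open>0\<close> on the boundaries of the cells, and it tends to \<open>-\<infinity>\<close> at infinity, so
  each cell contains a critical point of \<open>\<phi>\<close>.  The equations for critical points have the form
  \<open>x\<^sub>i\<^sup>r = p\<^sub>i(x)\<close> with \<open>r = 2 M D + 1 > deg p\<^sub>i\<close>; modulo them every polynomial is a combination of the
  \<open>r\<^sup>d\<close> monomials with all exponents below \<open>r\<close>, so they have at most \<open>r\<^sup>d\<close> common solutions
  (\<open>card_common_roots_le\<close>).

  The resulting inequality \<open>2\<^sup>N \<le> (2 p N D + 1)\<^sup>d\<close> is solved for \<open>N\<close> in
  \<open>card_bound_imp_log_bound\<close>.\<close>

unbundle no vec_syntax

section \<open>Polynomial functions in finitely many real variables\<close>

text \<open>\<open>polyfun V D f\<close>: the function \<open>f\<close> of a real point is given by a polynomial of total degree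
  at most \<open>D\<close> in the coordinates with index in \<open>V\<close>.  The coefficients lie in a real normed field,
  so that complex-valued polynomials of real variables are covered too.\<close>

inductive polyfun :: "'v set \<Rightarrow> nat \<Rightarrow> (('v \<Rightarrow> real) \<Rightarrow> 'b::real_normed_field) \<Rightarrow> bool" for V where
  const: "polyfun V D (\<lambda>x. c)"
| var_mult: "i \<in> V \<Longrightarrow> polyfun V D f \<Longrightarrow> polyfun V (Suc D) (\<lambda>x. of_real (x i) * f x)"
| add: "polyfun V D f \<Longrightarrow> polyfun V D g \<Longrightarrow> polyfun V D (\<lambda>x. f x + g x)"

lemma polyfun_mono: "polyfun V D f \<Longrightarrow> D \<le> E \<Longrightarrow> polyfun V E f"
proof (induction arbitrary: E rule: polyfun.induct)
  case (var_mult i D f)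
  then obtain E' where "E = Suc E'" "D \<le> E'" by (cases E) auto
  then show ?case using var_mult by (auto intro: polyfun.var_mult)
qed (auto intro: polyfun.intros)

lemma polyfun_var: "i \<in> V \<Longrightarrow> polyfun V 1 (\<lambda>x. of_real (x i))"
  using polyfun.var_mult[OF _ polyfun.const[of V 0 1]] by simp

lemma polyfun_scale: "polyfun V D f \<Longrightarrow> polyfun V D (\<lambda>x. c * f x)"
proof (induction rule: polyfun.induct)
  case (var_mult i D f)
  then have "polyfun V (Suc D) (\<lambda>x. of_real (x i) * (c * f x))" by (auto intro: polyfun.var_mult)
  then show ?case by (simp add: algebra_simps)
next
  case (add D f g)
  then show ?case by (auto simp: distrib_left intro: polyfun.add)
qed (auto intro: polyfun.intros)

lemma polyfun_mult: "polyfun V D f \<Longrightarrow> polyfun V E g \<Longrightarrow> polyfun V (D + E) (\<lambda>x. f x * g x)"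
proof (induction rule: polyfun.induct)
  case (const D c)
  then show ?case by (intro polyfun_mono[OF polyfun_scale, of V E]) auto
next
  case (var_mult i D f)
  then have "polyfun V (Suc (D + E)) (\<lambda>x. of_real (x i) * (f x * g x))"
    by (auto intro: polyfun.var_mult)
  then show ?case by (simp add: algebra_simps)
next
  case (add D f h)
  then show ?case by (auto simp: distrib_right intro: polyfun.add)
qed

lemma polyfun_diff:
  assumes "polyfun V D f" "polyfun V D g"
  shows "polyfun V D (\<lambda>x. f x - g x)"
  using polyfun.add[OF assms(1) polyfun_scale[OF assms(2), of "-1"]] by simp

lemma polyfun_sum:
  "(\<And>i. i \<in> I \<Longrightarrow> polyfun V D (f i)) \<Longrightarrow> polyfun V D (\<lambda>x. \<Sum>i\<in>I. f i x)"
  by (induction I rule: infinite_finite_induct) (auto intro: polyfun.intros)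

lemma polyfun_prod:
  "(\<And>i. i \<in> I \<Longrightarrow> polyfun V (D i) (f i)) \<Longrightarrow> polyfun V (sum D I) (\<lambda>x. \<Prod>i\<in>I. f i x)"
  by (induction I rule: infinite_finite_induct) (auto intro: polyfun.const polyfun_mult)

lemma polyfun_power:
  "polyfun V D f \<Longrightarrow> polyfun V (e * D) (\<lambda>x. f x ^ e)"
  using polyfun_prod[of "{..<e}" V "\<lambda>_. D" "\<lambda>_. f"] by simp

lemma polyfun_cnj: "polyfun V D f \<Longrightarrow> polyfun V D (\<lambda>x. cnj (f x))"
  by (induction rule: polyfun.induct) (auto intro: polyfun.intros)

lemma polyfun_Re: "polyfun V D f \<Longrightarrow> polyfun V D (\<lambda>x. Re (f x))"
proof (induction rule: polyfun.induct)
  case (var_mult i D f)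
  then show ?case using polyfun.var_mult[of i V D "\<lambda>x. Re (f x)"] by simp
qed (auto intro: polyfun.intros)

lemma polyfun_cong_coords:
  "polyfun V D f \<Longrightarrow> (\<And>i. i \<in> V \<Longrightarrow> x i = y i) \<Longrightarrow> f x = f y"
  by (induction rule: polyfun.induct) auto

lemma polyfun_continuous:
  fixes f :: "('v \<Rightarrow> real) \<Rightarrow> real"
  shows "polyfun V D f \<Longrightarrow> continuous_on UNIV f"
  by (induction rule: polyfun.induct) (auto intro!: continuous_intros)

lemma polyfun_growth:
  fixes f :: "('v \<Rightarrow> real) \<Rightarrow> real"
  assumes "polyfun V D f"
  shows "\<exists>C\<ge>0. \<forall>x R. R \<ge> 1 \<longrightarrow> (\<forall>i\<in>V. \<bar>x i\<bar> \<le> R) \<longrightarrow> \<bar>f x\<bar> \<le> C * R ^ D"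
  using assms
proof (induction rule: polyfun.induct)
  case (const D c)
  show ?case
    by (intro exI[of _ "\<bar>c\<bar>"]) (auto intro!: mult_left_le[of 1, simplified] simp: mult_le_cancel_left1 one_le_power)
next
  case (var_mult i D f)
  then obtain C where C: "C \<ge> 0" "\<And>x R. R \<ge> 1 \<Longrightarrow> (\<forall>i\<in>V. \<bar>x i\<bar> \<le> R) \<Longrightarrow> \<bar>f x\<bar> \<le> C * R ^ D"
    by blast
  show ?case
  proof (intro exI[of _ C] conjI allI impI C(1))
    fix x R assume a: "(1::real) \<le> R" "\<forall>i\<in>V. \<bar>x i\<bar> \<le> R"
    have "\<bar>x i\<bar> * \<bar>f x\<bar> \<le> R * (C * R ^ D)"
      using a C var_mult(1) by (intro mult_mono) auto
    then show "\<bar>of_real (x i) * f x\<bar> \<le> C * R ^ Suc D" by (simp add: abs_mult algebra_simps)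
  qed
next
  case (add D f g)
  then obtain C C' where C: "C \<ge> 0" "\<And>x R. R \<ge> 1 \<Longrightarrow> (\<forall>i\<in>V. \<bar>x i\<bar> \<le> R) \<Longrightarrow> \<bar>f x\<bar> \<le> C * R ^ D"
    and C': "C' \<ge> 0" "\<And>x R. R \<ge> 1 \<Longrightarrow> (\<forall>i\<in>V. \<bar>x i\<bar> \<le> R) \<Longrightarrow> \<bar>g x\<bar> \<le> C' * R ^ D"
    by blast
  show ?case
  proof (intro exI[of _ "C + C'"] conjI allI impI)
    fix x R assume a: "(1::real) \<le> R" "\<forall>i\<in>V. \<bar>x i\<bar> \<le> R"
    have "\<bar>f x + g x\<bar> \<le> \<bar>f x\<bar> + \<bar>g x\<bar>" by (rule abs_triangle_ineq)
    also have "\<dots> \<le> C * R ^ D + C' * R ^ D" using C(2)[OF a] C'(2)[OF a] by (rule add_mono)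
    finally show "\<bar>f x + g x\<bar> \<le> (C + C') * R ^ D" by (simp add: distrib_right)
  qed (use C(1) C'(1) in simp)
qed

text \<open>The degree bound for the derivative is not sharp; the bound \<open>D\<close> suffices below.\<close>

lemma polyfun_partial_derivative:
  fixes f :: "('v \<Rightarrow> real) \<Rightarrow> real"
  assumes "polyfun V D f"
  shows "\<exists>f'. polyfun V D f' \<and> (\<forall>x. ((\<lambda>t. f (x(i := t))) has_real_derivative f' x) (at (x i)))"
  using assms
proof (induction rule: polyfun.induct)
  case (const D c)
  show ?case by (intro exI[of _ "\<lambda>_. 0"]) (auto intro: polyfun.const)
next
  case (var_mult j D f)
  then obtain f' where f': "polyfun V D f'"
    "\<And>x. ((\<lambda>t. f (x(i := t))) has_real_derivative f' x) (at (x i))" by blast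
  show ?case
  proof (cases "i = j")
    case True
    have "polyfun V (Suc D) (\<lambda>x. f x + of_real (x j) * f' x)"
      using var_mult f' by (intro polyfun.add polyfun.var_mult) (auto intro: polyfun_mono)
    moreover have "((\<lambda>t. of_real ((x(i := t)) j) * f (x(i := t))) has_real_derivative
        f x + of_real (x j) * f' x) (at (x i))" for x
      using True f'(2)[of x] by (auto intro!: derivative_eq_intros)
    ultimately show ?thesis by blast
  next
    case False
    have "polyfun V (Suc D) (\<lambda>x. of_real (x j) * f' x)"
      using var_mult f' by (intro polyfun.var_mult) auto
    moreover have "((\<lambda>t. of_real ((x(i := t)) j) * f (x(i := t))) has_real_derivative
        of_real (x j) * f' x) (at (x i))" for x
      using False by (auto intro!: derivative_eq_intros f'(2)[of x])
    ultimately show ?thesis by blast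
  qed
next
  case (add D f g)
  then obtain f' g' where "polyfun V D f'" "polyfun V D g'"
    "\<And>x. ((\<lambda>t. f (x(i := t))) has_real_derivative f' x) (at (x i))"
    "\<And>x. ((\<lambda>t. g (x(i := t))) has_real_derivative g' x) (at (x i))" by blast
  then show ?case
    by (intro exI[of _ "\<lambda>x. f' x + g' x"] conjI allI polyfun.add DERIV_add)
qed


section \<open>Common roots of equations \<open>x\<^sub>i\<^sup>r = p\<^sub>i(x)\<close> with \<open>deg p\<^sub>i < r\<close>\<close>

text \<open>The monomial with exponents \<open>e\<close>, evaluated at \<open>x\<close>; only the exponents with index in \<open>V\<close>
  matter.\<close>

definition monom_at :: "'v set \<Rightarrow> ('v \<Rightarrow> nat) \<Rightarrow> ('v \<Rightarrow> real) \<Rightarrow> real" where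
  "monom_at V e x = (\<Prod>i\<in>V. x i ^ e i)"

lemma monom_at_Suc:
  assumes "finite V" "i \<in> V"
  shows "monom_at V (e(i := Suc (e i))) x = x i * monom_at V e x"
  using assms by (simp add: monom_at_def prod.remove[of V i])

lemma sum_upd_Suc:
  assumes "finite V" "i \<in> V"
  shows "(\<Sum>j\<in>V. (e(i := Suc (e i))) j) = Suc (\<Sum>j\<in>V. e j)"
  using assms by (simp add: sum.remove[of V i])

text \<open>A functional \<open>f \<mapsto> \<Sum>\<^sub>x\<^sub>\<in>\<^sub>X c\<^sub>x f(x)\<close> that kills all monomials up to a given degree kills all
  polynomials up to that degree.  The extra monomial factor makes the induction over \<open>f\<close> work.\<close>

lemma annihilates_polyfun_monom:
  fixes f :: "('v \<Rightarrow> real) \<Rightarrow> real"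
  assumes V: "finite V" and "polyfun V D f"
    and "\<And>e'. (\<Sum>i\<in>V. e' i) \<le> D + (\<Sum>i\<in>V. e i) \<Longrightarrow> (\<Sum>x\<in>X. c x * monom_at V e' x) = 0"
  shows "(\<Sum>x\<in>X. c x * (f x * monom_at V e x)) = 0"
  using assms(2,3)
proof (induction arbitrary: e rule: polyfun.induct)
  case (const D a)
  have "(\<Sum>x\<in>X. c x * (a * monom_at V e x)) = a * (\<Sum>x\<in>X. c x * monom_at V e x)"
    by (simp add: sum_distrib_left algebra_simps)
  then show ?case using const[of e] by simp
next
  case (var_mult i D f)
  have "(\<Sum>x\<in>X. c x * (f x * monom_at V (e(i := Suc (e i))) x)) = 0"
    using var_mult.prems by (intro var_mult.IH) (simp only: sum_upd_Suc[OF V var_mult(1)] add_Suc_right add_Suc)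
  then show ?case by (simp add: monom_at_Suc[OF V var_mult(1)] algebra_simps)
next
  case (add D f g)
  then show ?case by (simp add: distrib_left distrib_right sum.distrib)
qed

text \<open>Gaussian elimination, one equation at a time.\<close>

lemma homogeneous_system_nontrivial_solution:
  fixes a :: "'k \<Rightarrow> 'x \<Rightarrow> real"
  assumes "finite K" "finite X" "card K < card X"
  shows "\<exists>c. (\<exists>x\<in>X. c x \<noteq> 0) \<and> (\<forall>k\<in>K. (\<Sum>x\<in>X. c x * a k x) = 0)"
  using assms
proof (induction K arbitrary: X a rule: finite_induct)
  case empty
  then obtain x where "x \<in> X" by fastforce
  then show ?case by (intro exI[of _ "\<lambda>_. 1"]) auto
next
  case (insert k K)
  show ?case
  proof (cases "\<forall>x\<in>X. a k x = 0")
    case True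
    have "card K < card X" using insert by simp
    from insert.IH[OF insert.prems(1) this, of a] True show ?thesis by auto
  next
    case False
    then obtain z where z: "z \<in> X" "a k z \<noteq> 0" by blast
    define b where "b l x = a l x - a l z * a k x / a k z" for l x
    have "card K < card (X - {z})" using insert z by simp
    from insert.IH[OF _ this, of b] insert.prems obtain c where
      c: "\<exists>x\<in>X - {z}. c x \<noteq> 0" "\<And>l. l \<in> K \<Longrightarrow> (\<Sum>x\<in>X - {z}. c x * b l x) = 0" by auto
    define c' where "c' = c(z := - (\<Sum>x\<in>X - {z}. c x * a k x) / a k z)"
    have split: "(\<Sum>x\<in>X. c' x * a l x) = c' z * a l z + (\<Sum>x\<in>X - {z}. c x * a l x)" for l
      using z insert.prems by (subst sum.remove[of X z]) (auto simp: c'_def intro!: sum.cong)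
    have "(\<Sum>x\<in>X. c' x * a l x) = (\<Sum>x\<in>X - {z}. c x * b l x)" for l
    proof -
      have "(\<Sum>x\<in>X - {z}. c x * b l x)
          = (\<Sum>x\<in>X - {z}. c x * a l x) - (\<Sum>x\<in>X - {z}. c x * a k x) * (a l z / a k z)"
        unfolding b_def by (simp add: sum_subtractf sum_distrib_left sum_divide_distrib algebra_simps)
      then show ?thesis unfolding split by (simp add: c'_def)
    qed
    moreover have "(\<Sum>x\<in>X. c' x * a k x) = 0"
      unfolding split using z by (simp add: c'_def)
    moreover have "\<exists>x\<in>X. c' x \<noteq> 0" using c(1) by (auto simp: c'_def)
    ultimately show ?thesis using c(2) by (intro exI[of _ c']) auto
  qed
qed

lemma polyfun_interpolation:
  assumes "finite X" "x0 \<in> X" "\<And>x. x \<in> X \<Longrightarrow> x \<noteq> x0 \<Longrightarrow> \<exists>i\<in>V. x i \<noteq> x0 i"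
  shows "\<exists>D f. polyfun V D f \<and> f x0 = (1::real) \<and> (\<forall>x\<in>X. x \<noteq> x0 \<longrightarrow> f x = 0)"
proof -
  obtain s where s: "\<And>x. x \<in> X \<Longrightarrow> x \<noteq> x0 \<Longrightarrow> s x \<in> V \<and> x (s x) \<noteq> x0 (s x)"
    using assms(3) by metis
  define f where "f y = (\<Prod>x\<in>X - {x0}. (y (s x) - x (s x)) / (x0 (s x) - x (s x)))" for y :: "'a \<Rightarrow> real"
  have p: "polyfun V 1 (\<lambda>y. (y (s x) - x (s x)) / (x0 (s x) - x (s x)))" if "x \<in> X - {x0}" for x
    using polyfun_scale[OF polyfun_diff[OF polyfun_var[of "s x" V] polyfun.const[of _ _ "x (s x)"]],
        of "1 / (x0 (s x) - x (s x))"] s[of x] that by simp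
  have "polyfun V (\<Sum>x\<in>X - {x0}. 1) f"
    unfolding f_def by (rule polyfun_prod) (rule p)
  moreover have "f x0 = 1" unfolding f_def using s by (intro prod.neutral) fastforce
  moreover have "f x = 0" if "x \<in> X" "x \<noteq> x0" for x
    unfolding f_def using that assms(1) by (intro prod_zero) auto
  ultimately show ?thesis by blast
qed

text \<open>The equations allow every polynomial to be replaced, on the set of common roots, by one with
  all exponents below \<open>r\<close>; as any function on a finite set of points is polynomial, there are at most
  as many roots as such monomials.\<close>

lemma card_common_roots_le:
  fixes p :: "'v \<Rightarrow> ('v \<Rightarrow> real) \<Rightarrow> real"
  assumes V: "finite V" and X: "finite X"
    and sep: "\<And>x y. x \<in> X \<Longrightarrow> y \<in> X \<Longrightarrow> x \<noteq> y \<Longrightarrow> \<exists>i\<in>V. x i \<noteq> y i"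
    and p: "\<And>i. i \<in> V \<Longrightarrow> polyfun V d (p i)"
    and root: "\<And>x i. x \<in> X \<Longrightarrow> i \<in> V \<Longrightarrow> x i ^ Suc d = p i x"
  shows "card X \<le> Suc d ^ card V"
proof (rule ccontr)
  assume "\<not> card X \<le> Suc d ^ card V"
  moreover define K where "K = (\<Pi>\<^sub>E i\<in>V. {..d})"
  have finK: "finite K" and cardK: "card K = Suc d ^ card V"
    using V by (auto simp: K_def card_PiE finite_PiE)
  ultimately obtain c x0 where x0: "x0 \<in> X" "c x0 \<noteq> 0"
    and c: "\<And>e. e \<in> K \<Longrightarrow> (\<Sum>x\<in>X. c x * monom_at V e x) = 0"
    using homogeneous_system_nontrivial_solution[OF finK X, of "monom_at V"] by auto
  \<comment> \<open>If some exponent exceeds \<open>d\<close>, the equation for that variable lowers the total degree.\<close>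
  have killmon: "(\<Sum>x\<in>X. c x * monom_at V e x) = 0" for e
  proof (induction "\<Sum>i\<in>V. e i" arbitrary: e rule: less_induct)
    case less
    show ?case
    proof (cases "\<forall>i\<in>V. e i \<le> d")
      case True
      have "monom_at V (restrict e V) = monom_at V e" by (auto simp: monom_at_def fun_eq_iff)
      moreover have "restrict e V \<in> K" using True by (auto simp: K_def)
      ultimately show ?thesis using c by metis
    next
      case False
      then obtain i where i: "i \<in> V" "e i > d" by (auto simp: not_le)
      define e' where "e' = e(i := e i - Suc d)"
      have se: "(\<Sum>j\<in>V. e j) = (\<Sum>j\<in>V. e' j) + Suc d"
        using i V by (simp add: e'_def sum.remove[of V i])
      have "monom_at V e x = x i ^ Suc d * monom_at V e' x" for x
        using i V by (simp add: e'_def monom_at_def prod.remove[of V i] flip: power_Suc power_add mult.assoc)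
      then have "(\<Sum>x\<in>X. c x * monom_at V e x) = (\<Sum>x\<in>X. c x * (p i x * monom_at V e' x))"
        using root i by (intro sum.cong) auto
      also have "\<dots> = 0"
      proof (rule annihilates_polyfun_monom[OF V p[OF i(1)]])
        fix e'' assume "(\<Sum>i\<in>V. e'' i) \<le> d + (\<Sum>i\<in>V. e' i)"
        then have "(\<Sum>i\<in>V. e'' i) < (\<Sum>i\<in>V. e i)" using se by simp
        then show "(\<Sum>x\<in>X. c x * monom_at V e'' x) = 0" by (rule less)
      qed
      finally show ?thesis .
    qed
  qed
  obtain D f where f: "polyfun V D f" "f x0 = (1::real)" "\<And>x. x \<in> X \<Longrightarrow> x \<noteq> x0 \<Longrightarrow> f x = 0"
    using polyfun_interpolation[OF X x0(1), of V] sep x0(1) by metis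
  have "(\<Sum>x\<in>X. c x * (f x * monom_at V (\<lambda>_. 0) x)) = 0"
    by (rule annihilates_polyfun_monom[OF V f(1)]) (rule killmon)
  moreover have "(\<Sum>x\<in>X. c x * (f x * monom_at V (\<lambda>_. 0) x)) = (\<Sum>x\<in>X. if x = x0 then c x0 else 0)"
    using f by (intro sum.cong) (auto simp: monom_at_def)
  ultimately show False using X x0 by simp
qed


section \<open>Counting sign patterns\<close>

text \<open>The points of \<open>X\<close> lie in pairwise different sign cells of the polynomials \<open>F a\<close>.  The proof
  replaces each of them by a maximum point, over its closed cell, of
  \<open>g(y) - \<epsilon> \<Sum>\<^sub>i y\<^sub>i\<^sup>d\<^sup>+\<^sup>2\<close>, where \<open>g\<close> is the square of the product of the polynomials and \<open>d\<close> bounds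
  its degree.\<close>

lemma card_sign_cells_le:
  fixes F :: "'a \<Rightarrow> ('v \<Rightarrow> real) \<Rightarrow> real"
  assumes V: "finite V" and I: "finite I" and X: "finite X"
    and F: "\<And>a. a \<in> I \<Longrightarrow> polyfun V D (F a)"
    and nz: "\<And>a x. a \<in> I \<Longrightarrow> x \<in> X \<Longrightarrow> F a x \<noteq> 0"
    and sep: "\<And>x y. x \<in> X \<Longrightarrow> y \<in> X \<Longrightarrow> x \<noteq> y \<Longrightarrow> \<exists>a\<in>I. F a x * F a y < 0"
  shows "card X \<le> Suc (2 * (card I * D)) ^ card V"
proof (cases "X = {}")
  case False
  define d where "d = 2 * (card I * D)"
  define g where "g y = (\<Prod>a\<in>I. F a y)\<^sup>2" for y
  have g: "polyfun V d g"
    using polyfun_power[OF polyfun_prod[of I V "\<lambda>_. D" F], of 2] F by (simp add: g_def[abs_def] d_def)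
  obtain C where C: "C \<ge> 0" "\<And>x R. R \<ge> 1 \<Longrightarrow> \<forall>i\<in>V. \<bar>x i\<bar> \<le> R \<Longrightarrow> \<bar>g x\<bar> \<le> C * R ^ d"
    using polyfun_growth[OF g] by blast
  define S where "S y = (\<Sum>i\<in>V. y i ^ (d + 2))" for y :: "'v \<Rightarrow> real"
  have even: "even (d + 2)" by (simp add: d_def)
  have Snonneg: "S y \<ge> 0" for y unfolding S_def by (intro sum_nonneg zero_le_even_power[OF even])
  have gpos: "g x > 0" if "x \<in> X" for x
    unfolding g_def using nz[OF _ that] I by simp
  define \<epsilon> where "\<epsilon> = Min ((\<lambda>x. g x / (S x + 1)) ` X)"
  have eps: "\<epsilon> > 0" unfolding \<epsilon>_def
    using X False gpos Snonneg by (subst Min_gr_iff) (auto intro!: divide_pos_pos add_nonneg_pos)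
  have eps_less: "\<epsilon> * S x < g x" if "x \<in> X" for x
  proof -
    have "\<epsilon> \<le> g x / (S x + 1)" unfolding \<epsilon>_def using X that by auto
    then have "\<epsilon> * (S x + 1) \<le> g x"
      using Snonneg[of x] by (simp add: pos_le_divide_eq)
    then show ?thesis using eps by (simp add: distrib_left)
  qed
  define \<phi> where "\<phi> y = g y - \<epsilon> * S y" for y
  have contF: "continuous_on UNIV (F a)" if "a \<in> I" for a
    using polyfun_continuous F that by blast
  have cont\<phi>: "continuous_on UNIV \<phi>"
    unfolding \<phi>_def S_def using polyfun_continuous[OF g] by (auto intro!: continuous_intros)
  define R where "R = 1 + C / \<epsilon>"
  \<comment> \<open>Since \<open>deg g < d + 2\<close>, the set where \<open>\<phi>\<close> is nonnegative is bounded.\<close>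
  have bounded: "- R \<le> y i \<and> y i \<le> R" if y: "\<phi> y \<ge> 0" and i: "i \<in> V" for y i
  proof -
    define \<rho> where "\<rho> = Max (insert 1 ((\<lambda>i. \<bar>y i\<bar>) ` V))"
    have \<rho>: "\<rho> \<ge> 1" "\<And>j. j \<in> V \<Longrightarrow> \<bar>y j\<bar> \<le> \<rho>" unfolding \<rho>_def using V by auto
    have "\<rho> \<le> R"
    proof (cases "\<rho> = 1")
      case True
      then show ?thesis using C eps by (simp add: R_def)
    next
      case False
      have "\<rho> \<in> insert 1 ((\<lambda>i. \<bar>y i\<bar>) ` V)" unfolding \<rho>_def using V by (intro Max_in) auto
      then obtain j where j: "j \<in> V" "\<rho> = \<bar>y j\<bar>" using False by auto
      have "\<rho> ^ (d + 2) = y j ^ (d + 2)" using even j by (simp only: power_even_abs)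
      also have "\<dots> \<le> S y" unfolding S_def
        using V j zero_le_even_power[OF even] by (intro member_le_sum) auto
      finally have "\<epsilon> * \<rho> ^ (d + 2) \<le> g y"
        using y eps unfolding \<phi>_def by (smt (verit) mult_left_mono)
      also have "g y \<le> C * \<rho> ^ d" using C(2)[OF \<rho>(1)] \<rho>(2) by (metis abs_le_D1)
      finally have "(\<epsilon> * \<rho>\<^sup>2) * \<rho> ^ d \<le> C * \<rho> ^ d" by (simp add: power_add mult_ac power2_eq_square)
      then have "\<epsilon> * \<rho>\<^sup>2 \<le> C" using \<rho>(1) by (simp add: mult_le_cancel_right)
      moreover have "\<rho> \<le> \<rho>\<^sup>2" using \<rho>(1) by (simp add: power2_eq_square)
      ultimately have "\<epsilon> * \<rho> \<le> C" using eps by (smt (verit) mult_left_mono)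
      then show ?thesis using eps by (simp add: R_def field_simps)
    qed
    then show ?thesis using \<rho>(2)[OF i] by (simp add: abs_le_iff)
  qed
  define B where "B = PiE UNIV (\<lambda>i. if i \<in> V then {-R..R} else {0})"
  have "compactin (product_topology (\<lambda>_. euclidean) UNIV) B"
    unfolding B_def compactin_PiE by (auto simp: compactin_euclidean_iff)
  then have compB: "compact B" by (simp add: euclidean_product_topology compactin_euclidean_iff)
  define Q where "Q x = B \<inter> ({y. 0 \<le> \<phi> y} \<inter> (\<Inter>a\<in>I. {y. 0 \<le> F a y * F a x}))" for x
  \<comment> \<open>Coordinates outside \<open>V\<close> are irrelevant and are set to \<open>0\<close> to make the domain compact.\<close>
  define z where "z x = (\<lambda>i. if i \<in> V then x i else 0)" for x :: "'v \<Rightarrow> real"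
  have Fz: "F a (z x) = F a x" if "a \<in> I" for a x
    by (rule polyfun_cong_coords[OF F[OF that]]) (simp add: z_def)
  have phiz: "\<phi> (z x) > 0" if "x \<in> X" for x
  proof -
    have "g (z x) = g x" by (rule polyfun_cong_coords[OF g]) (simp add: z_def)
    moreover have "S (z x) = S x" by (simp add: S_def z_def)
    ultimately show ?thesis using eps_less[OF that] by (simp add: \<phi>_def)
  qed
  have critical: "\<exists>y. (\<forall>i. i \<notin> V \<longrightarrow> y i = 0) \<and> (\<forall>a\<in>I. F a y * F a x > 0) \<and>
      (\<forall>i\<in>V. \<forall>l. ((\<lambda>t. \<phi> (y(i := t))) has_real_derivative l) (at (y i)) \<longrightarrow> l = 0)"
    if x: "x \<in> X" for x
  proof -
    have "closed ({y. 0 \<le> \<phi> y} \<inter> (\<Inter>a\<in>I. {y. 0 \<le> F a y * F a x}))"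
      by (intro closed_Int closed_INT ballI closed_Collect_le cont\<phi> continuous_intros contF)
    then have "compact (Q x)" unfolding Q_def by (intro compact_Int_closed compB)
    moreover have "z x \<in> Q x"
      using phiz[OF x] bounded[of "z x"] by (auto simp: Q_def B_def Fz less_imp_le) (auto simp: z_def)
    moreover have "continuous_on (Q x) \<phi>" using cont\<phi> continuous_on_subset by blast
    \<comment> \<open>The maximum is positive, so no \<open>F a\<close> vanishes where it is attained.\<close>
    ultimately obtain y where y: "y \<in> Q x" "\<And>y'. y' \<in> Q x \<Longrightarrow> \<phi> y' \<le> \<phi> y"
      using continuous_attains_sup[of "Q x" \<phi>] by blast
    have ypos: "\<phi> y > 0" using phiz[OF x] y(2)[OF \<open>z x \<in> Q x\<close>] by linarith
    then have "g y \<noteq> 0" using Snonneg[of y] eps by (auto simp: \<phi>_def mult_less_0_iff)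
    then have Fy: "F a y * F a x > 0" if "a \<in> I" for a
      using y(1) that nz[OF that x] I unfolding g_def Q_def by (force simp: order_less_le)
    have supp: "\<forall>i. i \<notin> V \<longrightarrow> y i = 0" using y(1) by (auto simp: Q_def B_def PiE_iff split: if_splits)
    have "l = 0" if i: "i \<in> V" and l: "((\<lambda>t. \<phi> (y(i := t))) has_real_derivative l) (at (y i))" for i l
    proof -
      have tend: "((\<lambda>t. h (y(i := t))) \<longlongrightarrow> h y) (nhds (y i))"
        if "((\<lambda>t. h (y(i := t))) has_real_derivative l) (at (y i))" for h :: "('v \<Rightarrow> real) \<Rightarrow> real" and l
        using DERIV_isCont[OF that] tendsto_at_iff_tendsto_nhds[of "\<lambda>t. h (y(i := t))" "y i"]
        by (simp add: isCont_def)
      have "\<forall>\<^sub>F t in nhds (y i). F a (y(i := t)) * F a x > 0" if a: "a \<in> I" for a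
      proof -
        obtain l where "((\<lambda>t. F a (y(i := t))) has_real_derivative l) (at (y i))"
          using polyfun_partial_derivative[OF F[OF a]] by blast
        from tendsto_mult_right[OF tend[OF this], of "F a x"] Fy[OF a]
        show ?thesis by (rule order_tendstoD)
      qed
      then have "\<forall>\<^sub>F t in nhds (y i). \<forall>a\<in>I. F a (y(i := t)) * F a x > 0"
        by (intro eventually_ball_finite I) auto
      moreover have "\<forall>\<^sub>F t in nhds (y i). \<phi> (y(i := t)) > 0"
        using tend[OF l] ypos by (rule order_tendstoD)
      ultimately have "\<forall>\<^sub>F t in nhds (y i). \<phi> (y(i := t)) \<le> \<phi> y"
      proof eventually_elim
        case (elim t)
        then have "y(i := t) \<in> Q x"
          using bounded[of "y(i := t)"] supp i
          by (auto simp: Q_def B_def less_imp_le simp del: fun_upd_apply) auto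
        then show ?case by (rule y(2))
      qed
      then obtain e where "e > 0" "\<And>t. dist t (y i) < e \<Longrightarrow> \<phi> (y(i := t)) \<le> \<phi> y"
        unfolding eventually_nhds_metric by blast
      then show "l = 0"
        by (intro DERIV_local_max[OF l, of e]) (auto simp: dist_real_def abs_minus_commute)
    qed
    then show ?thesis using supp Fy by blast
  qed
  have "\<forall>x\<in>X. \<exists>y. (\<forall>i. i \<notin> V \<longrightarrow> y i = 0) \<and> (\<forall>a\<in>I. F a y * F a x > 0) \<and>
      (\<forall>i\<in>V. \<forall>l. ((\<lambda>t. \<phi> (y(i := t))) has_real_derivative l) (at (y i)) \<longrightarrow> l = 0)"
    using critical by blast
  then obtain Y where supp: "\<And>x i. x \<in> X \<Longrightarrow> i \<notin> V \<Longrightarrow> Y x i = 0"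
    and cell: "\<And>x a. x \<in> X \<Longrightarrow> a \<in> I \<Longrightarrow> F a (Y x) * F a x > 0"
    and crit: "\<And>x i l. x \<in> X \<Longrightarrow> i \<in> V \<Longrightarrow>
        ((\<lambda>t. \<phi> ((Y x)(i := t))) has_real_derivative l) (at (Y x i)) \<Longrightarrow> l = 0"
    by metis
  have inj: "inj_on Y X"
  proof
    fix x x' assume xx: "x \<in> X" "x' \<in> X" "Y x = Y x'"
    show "x = x'"
    proof (rule ccontr)
      assume "x \<noteq> x'"
      then obtain a where a: "a \<in> I" "F a x * F a x' < 0" using sep xx by blast
      show False using cell[OF xx(1) a(1)] cell[OF xx(2) a(1)] a(2) xx(3)
        by (auto simp: zero_less_mult_iff mult_less_0_iff)
    qed
  qed
  have "\<exists>g'. polyfun V d g' \<and> (\<forall>x. ((\<lambda>t. g (x(i := t))) has_real_derivative g' x) (at (x i)))" for i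
    by (rule polyfun_partial_derivative[OF g])
  then obtain g' where g': "\<And>i. polyfun V d (g' i)"
    "\<And>i x. ((\<lambda>t. g (x(i := t))) has_real_derivative g' i x) (at (x i))" by metis
  have "card (Y ` X) \<le> Suc d ^ card V"
  proof (rule card_common_roots_le[OF V])
    show "finite (Y ` X)" using X by simp
    show "polyfun V d (\<lambda>x. 1 / (\<epsilon> * real (d + 2)) * g' i x)" for i
      by (rule polyfun_scale[OF g'(1)])
    show "\<exists>i\<in>V. u i \<noteq> v i" if "u \<in> Y ` X" "v \<in> Y ` X" "u \<noteq> v" for u v
      using that supp by (metis ext image_iff)
    show "u i ^ Suc d = 1 / (\<epsilon> * real (d + 2)) * g' i u" if u: "u \<in> Y ` X" and i: "i \<in> V" for u i
    proof -
      obtain x where x: "x \<in> X" "u = Y x" using u by blast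
      have S_upd: "S (u(i := t)) = t ^ (d + 2) + (\<Sum>j\<in>V - {i}. u j ^ (d + 2))" for t
        unfolding S_def by (subst sum.remove[OF V i]) (auto intro!: sum.cong)
      have "((\<lambda>t. t ^ (d + 2)) has_real_derivative real (d + 2) * u i ^ (d + 1)) (at (u i))"
        using DERIV_pow[of "d + 2" "u i"] by simp
      from DERIV_diff[OF g'(2)[of u i] DERIV_cmult[OF DERIV_add[OF this DERIV_const], of \<epsilon>]]
      have "((\<lambda>t. \<phi> (u(i := t))) has_real_derivative g' i u - \<epsilon> * (real (d + 2) * u i ^ (d + 1))) (at (u i))"
        unfolding \<phi>_def S_upd by simp
      then have "g' i u - \<epsilon> * (real (d + 2) * u i ^ (d + 1)) = 0"
        using crit[OF x(1) i] x(2) by blast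
      then have "g' i u = (\<epsilon> * real (d + 2)) * u i ^ Suc d" by (simp add: algebra_simps)
      moreover have "\<epsilon> * real (d + 2) \<noteq> 0" using eps by simp
      ultimately show ?thesis by (metis nonzero_mult_div_cancel_left times_divide_eq_left mult_1)
    qed
  qed
  then show ?thesis using card_image[OF inj] by (simp add: d_def)
qed simp


section \<open>Fundamental matrices of linear differential equations\<close>

text \<open>\<open>fundamental n a E\<close>: the matrices \<open>E t\<close>, given by their entries, are the exponentials of
  \<open>t\<close> times the \<open>n \<times> n\<close> matrix with entries \<open>a\<close>.  Matrices of real functions are given by their
  entries, because the matrix type carries no topology; only indices below \<open>n\<close> matter.\<close>

definition fundamental :: "nat \<Rightarrow> (nat \<Rightarrow> nat \<Rightarrow> real) \<Rightarrow> (real \<Rightarrow> nat \<Rightarrow> nat \<Rightarrow> real) \<Rightarrow> bool" where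
  "fundamental n a E \<longleftrightarrow>
     (\<forall>i<n. \<forall>j<n. E 0 i j = (if i = j then 1 else 0)) \<and>
     (\<forall>i<n. \<forall>j<n. \<forall>t. ((\<lambda>t. E t i j) has_real_derivative (\<Sum>k<n. a i k * E t k j)) (at t)) \<and>
     (\<forall>i<n. \<forall>j<n. \<forall>t. ((\<lambda>t. E t i j) has_real_derivative (\<Sum>k<n. E t i k * a k j)) (at t))"

text \<open>The entries of the powers of the matrix \<open>a\<close>, which yield the coefficients of the exponential series.\<close>

fun mat_power :: "nat \<Rightarrow> (nat \<Rightarrow> nat \<Rightarrow> real) \<Rightarrow> nat \<Rightarrow> nat \<Rightarrow> nat \<Rightarrow> real" where
  "mat_power n a 0 i j = (if i = j then 1 else 0)"
| "mat_power n a (Suc q) i j = (\<Sum>k<n. a i k * mat_power n a q k j)"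

lemma mat_power_Suc_right:
  "i < n \<Longrightarrow> j < n \<Longrightarrow> mat_power n a (Suc q) i j = (\<Sum>k<n. mat_power n a q i k * a k j)"
proof (induction q arbitrary: i j)
  case 0
  then show ?case by (simp add: if_distrib[of "\<lambda>x. x * _"] if_distrib[of "\<lambda>x. _ * x"] cong: if_cong)
next
  case (Suc q)
  have "mat_power n a (Suc (Suc q)) i j = (\<Sum>k<n. a i k * mat_power n a (Suc q) k j)"
    by simp
  also have "\<dots> = (\<Sum>k<n. a i k * (\<Sum>l<n. mat_power n a q k l * a l j))"
    using Suc by (intro sum.cong) (simp_all del: mat_power.simps)
  also have "\<dots> = (\<Sum>l<n. mat_power n a (Suc q) i l * a l j)"
    by (simp add: sum_distrib_left sum_distrib_right mult.assoc) (rule sum.swap)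
  finally show ?case .
qed

lemma mat_power_bound:
  assumes "\<And>i j. i < n \<Longrightarrow> j < n \<Longrightarrow> \<bar>a i j\<bar> \<le> b" "b \<ge> 0" "i < n" "j < n"
  shows "\<bar>mat_power n a q i j\<bar> \<le> (real n * b) ^ q"
  using assms(3)
proof (induction q arbitrary: i)
  case (Suc q)
  have "\<bar>mat_power n a (Suc q) i j\<bar> \<le> (\<Sum>k<n. \<bar>a i k * mat_power n a q k j\<bar>)"
    by (simp add: sum_abs)
  also have "\<dots> \<le> (\<Sum>k<n. b * (real n * b) ^ q)"
    using Suc assms by (intro sum_mono) (auto simp: abs_mult intro!: mult_mono)
  finally show ?case by (simp add: algebra_simps)
qed auto

lemma fundamental_exists: "\<exists>E. fundamental n a E"
proof -
  define b where "b = (\<Sum>i<n. \<Sum>j<n. \<bar>a i j\<bar>)"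
  have b: "\<bar>a i j\<bar> \<le> b" if "i < n" "j < n" for i j
  proof -
    have "\<bar>a i j\<bar> \<le> (\<Sum>j<n. \<bar>a i j\<bar>)" using that by (intro member_le_sum) auto
    also have "\<dots> \<le> b" unfolding b_def using that by (intro member_le_sum) (auto intro: sum_nonneg)
    finally show ?thesis .
  qed
  have b0: "b \<ge> 0" unfolding b_def by (intro sum_nonneg) auto
  define c where "c i j q = mat_power n a q i j / fact q" for i j q
  define E where "E t i j = (\<Sum>q. c i j q * t ^ q)" for t i j
  have summ: "summable (\<lambda>q. c i j q * t ^ q)" if "i < n" "j < n" for i j t
  proof (rule summable_comparison_test')
    show "summable (\<lambda>q. inverse (fact q) * (real n * b * \<bar>t\<bar>) ^ q)"
      by (rule summable_exp)
    show "norm (c i j q * t ^ q) \<le> inverse (fact q) * (real n * b * \<bar>t\<bar>) ^ q" for q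
      using mat_power_bound[OF b b0 that, where q = q]
      by (auto simp: c_def abs_mult power_mult_distrib power_abs divide_simps intro!: mult_right_mono)
  qed
  have der: "((\<lambda>t. E t i j) has_real_derivative (\<Sum>q. diffs (c i j) q * t ^ q)) (at t)"
    if "i < n" "j < n" for i j t
    unfolding E_def using summ[OF that] by (rule termdiffs_strong_converges_everywhere)
  have diffs: "diffs (c i j) q = mat_power n a (Suc q) i j / fact q" for i j q
    by (simp add: diffs_def c_def divide_simps del: mat_power.simps)
  have left: "(\<Sum>q. diffs (c i j) q * t ^ q) = (\<Sum>k<n. a i k * E t k j)" if "i < n" "j < n" for i j t
  proof -
    have "(\<Sum>q. diffs (c i j) q * t ^ q) = (\<Sum>q. \<Sum>k<n. a i k * (c k j q * t ^ q))"
      unfolding diffs by (simp add: c_def sum_distrib_right sum_divide_distrib mult.assoc)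
    also have "\<dots> = (\<Sum>k<n. \<Sum>q. a i k * (c k j q * t ^ q))"
      using summ that by (intro suminf_sum summable_mult) auto
    also have "\<dots> = (\<Sum>k<n. a i k * E t k j)"
      unfolding E_def using summ that by (intro sum.cong) (auto intro!: suminf_mult)
    finally show ?thesis .
  qed
  have right: "(\<Sum>q. diffs (c i j) q * t ^ q) = (\<Sum>k<n. E t i k * a k j)" if "i < n" "j < n" for i j t
  proof -
    have "(\<Sum>q. diffs (c i j) q * t ^ q) = (\<Sum>q. \<Sum>k<n. a k j * (c i k q * t ^ q))"
      unfolding diffs mat_power_Suc_right[OF that]
      by (simp add: c_def sum_distrib_right sum_distrib_left sum_divide_distrib mult_ac)
    also have "\<dots> = (\<Sum>k<n. \<Sum>q. a k j * (c i k q * t ^ q))"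
      using summ that by (intro suminf_sum summable_mult) auto
    also have "\<dots> = (\<Sum>k<n. a k j * E t i k)"
      unfolding E_def using summ that by (intro sum.cong) (auto intro!: suminf_mult)
    finally show ?thesis by (simp add: mult.commute)
  qed
  have "E 0 i j = (if i = j then 1 else 0)" for i j
    using powser_zero[of "c i j"] by (simp add: E_def c_def)
  then have "fundamental n a E"
    unfolding fundamental_def by (auto simp: left[symmetric] right[symmetric] intro: der)
  then show ?thesis by (intro exI[of _ E])
qed

lemma fundamental_deriv_left:
  "fundamental n a E \<Longrightarrow> i < n \<Longrightarrow> j < n \<Longrightarrow>
    ((\<lambda>t. E t i j) has_real_derivative (\<Sum>k<n. a i k * E t k j)) (at t)"
  and fundamental_deriv_right:
  "fundamental n a E \<Longrightarrow> i < n \<Longrightarrow> j < n \<Longrightarrow>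
    ((\<lambda>t. E t i j) has_real_derivative (\<Sum>k<n. E t i k * a k j)) (at t)"
  and fundamental_0: "fundamental n a E \<Longrightarrow> i < n \<Longrightarrow> j < n \<Longrightarrow> E 0 i j = (if i = j then 1 else 0)"
  by (auto simp: fundamental_def)

lemma fundamental_comm:
  assumes "fundamental n a E" "i < n" "j < n"
  shows "(\<Sum>k<n. a i k * E t k j) = (\<Sum>k<n. E t i k * a k j)"
  using DERIV_unique[OF fundamental_deriv_left[OF assms] fundamental_deriv_right[OF assms]] .

lemma fundamental_deriv_reflected:
  assumes "fundamental n a E" "i < n" "j < n"
  shows "((\<lambda>t. E (c - t) i j) has_real_derivative - (\<Sum>k<n. E (c - t) i k * a k j)) (at t within S)"
proof -
  have "((\<lambda>t. c - t) has_real_derivative -1) (at t within S)"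
    by (auto intro!: derivative_eq_intros)
  from DERIV_chain2[OF fundamental_deriv_right[OF assms] this] show ?thesis by simp
qed

lemma fundamental_continuous:
  assumes "fundamental n a E" "i < n" "j < n"
  shows "continuous_on S (\<lambda>t. E t i j)"
  by (rule DERIV_continuous_on, rule has_field_derivative_at_within, rule fundamental_deriv_left[OF assms])

lemma fundamental_reflected_continuous:
  assumes "fundamental n a E" "i < n" "j < n"
  shows "continuous_on S (\<lambda>t. E (c - t) i j)"
  by (rule DERIV_continuous_on, rule fundamental_deriv_reflected[OF assms])

lemma fundamental_inverse:
  assumes E: "fundamental n a E" and ij: "i < n" "j < n"
  shows "(\<Sum>k<n. E t i k * E (- t) k j) = (if i = j then 1 else 0)"
proof -
  define h where "h t = (\<Sum>k<n. E t i k * E (- t) k j)" for t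
  have "(h has_real_derivative 0) (at t)" for t
  proof -
    have refl: "((\<lambda>t. E (- t) k j) has_real_derivative - (\<Sum>l<n. a k l * E (- t) l j)) (at t)" if "k < n" for k
      using fundamental_deriv_reflected[OF E that ij(2), of 0 t UNIV] fundamental_comm[OF E that ij(2), of "- t"]
      by simp
    have "(h has_real_derivative
        (\<Sum>k<n. E t i k * (- (\<Sum>l<n. a k l * E (- t) l j)) + (\<Sum>l<n. E t i l * a l k) * E (- t) k j)) (at t)"
      unfolding h_def
      by (intro DERIV_sum DERIV_mult' fundamental_deriv_right[OF E] ij refl) auto
    moreover have "(\<Sum>k<n. E t i k * (\<Sum>l<n. a k l * E (- t) l j)) = (\<Sum>k<n. (\<Sum>l<n. E t i l * a l k) * E (- t) k j)"
      by (simp add: sum_distrib_left sum_distrib_right mult.assoc) (rule sum.swap)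
    ultimately show ?thesis by (simp add: sum.distrib sum_negf sum_subtractf)
  qed
  then have "h t = h 0" by (intro DERIV_isconst_all) auto
  also have "\<dots> = (if i = j then 1 else 0)"
    using ij by (simp add: h_def fundamental_0[OF E] if_distrib[of "\<lambda>x. x * _"] if_distrib[of "\<lambda>x. _ * x"] cong: if_cong)
  finally show ?thesis by (simp add: h_def)
qed

text \<open>Adding \<open>\<epsilon>\<close> to the diagonal multiplies the exponentials by \<open>e\<^sup>\<epsilon>\<^sup>t\<close>.\<close>

lemma fundamental_shift:
  assumes E: "fundamental n a E"
  shows "fundamental n (\<lambda>i j. a i j + (if i = j then \<epsilon> else 0)) (\<lambda>t i j. exp (\<epsilon> * t) * E t i j)"
proof -
  have l: "(\<Sum>k<n. (a i k + (if i = k then \<epsilon> else 0)) * (exp (\<epsilon> * t) * E t k j))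
      = exp (\<epsilon> * t) * (\<Sum>k<n. a i k * E t k j) + \<epsilon> * exp (\<epsilon> * t) * E t i j" if "i < n" for i j t
    using that by (simp add: distrib_right sum.distrib sum_distrib_left algebra_simps
        if_distrib[of "\<lambda>x. x * _"] if_distrib[of "\<lambda>x. _ * x"] cong: if_cong)
  have r: "(\<Sum>k<n. exp (\<epsilon> * t) * E t i k * (a k j + (if k = j then \<epsilon> else 0)))
      = exp (\<epsilon> * t) * (\<Sum>k<n. E t i k * a k j) + \<epsilon> * exp (\<epsilon> * t) * E t i j" if "j < n" for i j t
    using that by (simp add: distrib_left sum.distrib sum_distrib_left algebra_simps
        if_distrib[of "\<lambda>x. x * _"] if_distrib[of "\<lambda>x. _ * x"] cong: if_cong)
  have e: "((\<lambda>t. exp (\<epsilon> * t)) has_real_derivative exp (\<epsilon> * t) * \<epsilon>) (at t)" for t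
    by (auto intro!: derivative_eq_intros)
  show ?thesis
    unfolding fundamental_def
  proof (intro conjI allI impI)
    fix i j t assume ij: "i < n" "j < n"
    show "exp (\<epsilon> * 0) * E 0 i j = (if i = j then 1 else 0)" using fundamental_0[OF E ij] by simp
    show "((\<lambda>t. exp (\<epsilon> * t) * E t i j) has_real_derivative
        (\<Sum>k<n. (a i k + (if i = k then \<epsilon> else 0)) * (exp (\<epsilon> * t) * E t k j))) (at t)"
      unfolding l[OF ij(1)] using DERIV_mult'[OF e fundamental_deriv_left[OF E ij], of t] by (simp add: mult_ac)
    show "((\<lambda>t. exp (\<epsilon> * t) * E t i j) has_real_derivative
        (\<Sum>k<n. exp (\<epsilon> * t) * E t i k * (a k j + (if k = j then \<epsilon> else 0)))) (at t)"
      unfolding r[OF ij(2)] using DERIV_mult'[OF e fundamental_deriv_right[OF E ij], of t] by (simp add: mult_ac)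
  qed
qed

text \<open>Differentiating \<open>E (1 - s) x(s)\<close> yields the final value of any solution, and thereby its
  uniqueness.\<close>

lemma variation_of_constants:
  assumes E: "fundamental n a E"
    and x: "\<And>i t. i < n \<Longrightarrow> t \<in> {0..1} \<Longrightarrow>
        ((\<lambda>t. x t i) has_real_derivative (\<Sum>j<n. a i j * x t j) + f t i) (at t within {0..1})"
    and i: "i < n"
  shows "x 1 i = (\<Sum>j<n. E 1 i j * x 0 j) + integral {0..1} (\<lambda>s. \<Sum>j<n. E (1 - s) i j * f s j)"
proof -
  define h where "h s = (\<Sum>j<n. E (1 - s) i j * x s j)" for s
  have "(h has_real_derivative (\<Sum>j<n. E (1 - s) i j * f s j)) (at s within {0..1})" if s: "s \<in> {0..1}" for s
  proof -
    have "(h has_real_derivative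
       (\<Sum>j<n. E (1 - s) i j * ((\<Sum>k<n. a j k * x s k) + f s j) + - (\<Sum>k<n. E (1 - s) i k * a k j) * x s j))
       (at s within {0..1})"
      unfolding h_def
      by (intro DERIV_sum DERIV_mult' fundamental_deriv_reflected[OF E] i x s) auto
    moreover have "(\<Sum>j<n. E (1 - s) i j * (\<Sum>k<n. a j k * x s k)) = (\<Sum>j<n. (\<Sum>k<n. E (1 - s) i k * a k j) * x s j)"
      by (simp add: sum_distrib_left sum_distrib_right mult.assoc) (rule sum.swap)
    ultimately show ?thesis by (simp add: sum.distrib sum_negf sum_subtractf distrib_left)
  qed
  then have "((\<lambda>s. \<Sum>j<n. E (1 - s) i j * f s j) has_integral h 1 - h 0) {0..1}"
    by (intro fundamental_theorem_of_calculus) (auto simp: has_real_derivative_iff_has_vector_derivative)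
  moreover have "h 1 = x 1 i"
    using i by (simp add: h_def fundamental_0[OF E] if_distrib[of "\<lambda>x. x * _"] if_distrib[of "\<lambda>x. _ * x"] cong: if_cong)
  ultimately show ?thesis by (simp add: integral_unique h_def)
qed

lemma linear_ode_solution_exists:
  assumes E: "fundamental n a E"
    and f: "\<And>i. i < n \<Longrightarrow> continuous_on {0..1} (\<lambda>t. f t i)"
  shows "\<exists>x. (\<forall>i<n. x 0 i = x0 i) \<and> (\<forall>i<n. \<forall>t\<in>{0..1}.
      ((\<lambda>t. x t i) has_real_derivative (\<Sum>j<n. a i j * x t j) + f t i) (at t within {0..1}))"
proof -
  define v where "v t j = x0 j + integral {0..t} (\<lambda>s. \<Sum>k<n. E (- s) j k * f s k)" for t j
  define x where "x t i = (\<Sum>j<n. E t i j * v t j)" for t i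
  have v: "((\<lambda>t. v t j) has_real_derivative (\<Sum>k<n. E (- t) j k * f t k)) (at t within {0..1})"
    if "j < n" "t \<in> {0..1}" for j t
  proof -
    have "continuous_on {0..1} (\<lambda>s. \<Sum>k<n. E (- s) j k * f s k)"
      using fundamental_reflected_continuous[OF E that(1), of _ "{0..1}" 0] f
      by (intro continuous_intros) auto
    from integral_has_real_derivative[OF this that(2)] show ?thesis
      unfolding v_def by (auto intro!: derivative_eq_intros)
  qed
  have "((\<lambda>t. x t i) has_real_derivative (\<Sum>j<n. a i j * x t j) + f t i) (at t within {0..1})"
    if i: "i < n" and t: "t \<in> {0..1}" for i t
  proof -
    have "((\<lambda>t. x t i) has_real_derivative
        (\<Sum>j<n. E t i j * (\<Sum>k<n. E (- t) j k * f t k) + (\<Sum>k<n. a i k * E t k j) * v t j)) (at t within {0..1})"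
      unfolding x_def
      by (intro DERIV_sum DERIV_mult' v t has_field_derivative_at_within[OF fundamental_deriv_left[OF E i]]) auto
    moreover have "(\<Sum>j<n. E t i j * (\<Sum>k<n. E (- t) j k * f t k)) = (\<Sum>k<n. (\<Sum>j<n. E t i j * E (- t) j k) * f t k)"
      by (simp add: sum_distrib_left sum_distrib_right mult.assoc) (rule sum.swap)
    moreover have "\<dots> = f t i"
      using i by (simp add: fundamental_inverse[OF E] if_distrib[of "\<lambda>x. x * _"] if_distrib[of "\<lambda>x. _ * x"] cong: if_cong)
    moreover have "(\<Sum>j<n. (\<Sum>k<n. a i k * E t k j) * v t j) = (\<Sum>k<n. a i k * x t k)"
      unfolding x_def by (simp add: sum_distrib_left sum_distrib_right mult.assoc) (rule sum.swap)
    ultimately show ?thesis by (simp add: sum.distrib add.commute)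
  qed
  moreover have "x 0 i = x0 i" if "i < n" for i
    using that by (simp add: x_def v_def fundamental_0[OF E] if_distrib[of "\<lambda>x. x * _"] if_distrib[of "\<lambda>x. _ * x"] cong: if_cong)
  ultimately show ?thesis by blast
qed

lemma final_output_formula:
  assumes \<Sigma>: "\<Sigma> \<in> linear_systems n m p"
    and E: "fundamental n (\<lambda>i j. sys_A \<Sigma> $$ (i, j)) E"
    and u: "\<And>t. t \<in> {0..1} \<Longrightarrow> u t \<in> carrier_vec m"
    and uc: "\<And>r. r < m \<Longrightarrow> continuous_on {0..1} (\<lambda>t. u t $ r)"
    and i: "i < p"
  shows "final_output \<Sigma> u $ i = (\<Sum>a<n. sys_C \<Sigma> $$ (i, a) *
    ((\<Sum>b<n. E 1 a b * sys_x0 \<Sigma> $ b) +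
     integral {0..1} (\<lambda>s. \<Sum>b<n. E (1 - s) a b * (\<Sum>r<m. sys_B \<Sigma> $$ (b, r) * u s $ r))))"
proof -
  define a where "a = (\<lambda>i j. sys_A \<Sigma> $$ (i, j))"
  define f where "f t i = (\<Sum>r<m. sys_B \<Sigma> $$ (i, r) * u t $ r)" for t i
  have A: "sys_A \<Sigma> \<in> carrier_mat n n" and B: "sys_B \<Sigma> \<in> carrier_mat n m"
    and C: "sys_C \<Sigma> \<in> carrier_mat p n" and x0: "sys_x0 \<Sigma> \<in> carrier_vec n"
    using \<Sigma> by (auto simp: linear_systems_def)
  have E: "fundamental n a E" using E by (simp add: a_def)
  have rhs: "(sys_A \<Sigma> *\<^sub>v y + sys_B \<Sigma> *\<^sub>v u t) $ i = (\<Sum>j<n. a i j * y $ j) + f t i"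
    if "i < n" "y \<in> carrier_vec n" "t \<in> {0..1}" for i t y
    using A B that u[OF that(3)] by (simp add: a_def f_def scalar_prod_def atLeast0LessThan)
  have fc: "continuous_on {0..1} (\<lambda>t. f t i)" for i
    unfolding f_def using uc by (intro continuous_intros) auto
  define w where "w = Matrix.vec n (\<lambda>i. (\<Sum>j<n. E 1 i j * sys_x0 \<Sigma> $ j) +
      integral {0..1} (\<lambda>s. \<Sum>j<n. E (1 - s) i j * f s j))"
  \<comment> \<open>Both existence and uniqueness are needed to evaluate the definite description.\<close>
  have unique: "x 1 = w" if x: "is_trajectory \<Sigma> u x" for x
  proof -
    have x0': "x 0 = sys_x0 \<Sigma>" and xc: "\<And>t. t \<in> {0..1} \<Longrightarrow> x t \<in> carrier_vec n"
      and xd: "\<And>t i. t \<in> {0..1} \<Longrightarrow> i < n \<Longrightarrow>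
        ((\<lambda>s. x s $ i) has_real_derivative (sys_A \<Sigma> *\<^sub>v x t + sys_B \<Sigma> *\<^sub>v u t) $ i) (at t within {0..1})"
      using x A by (auto simp: is_trajectory_def)
    have "x 1 $ i = w $ i" if "i < n" for i
      using variation_of_constants[OF E, of "\<lambda>t i. x t $ i" f i] xd rhs xc x0' that
      by (simp add: w_def)
    then show ?thesis using xc[of 1] by (intro eq_vecI) (auto simp: w_def)
  qed
  obtain x where x: "\<And>i. i < n \<Longrightarrow> x 0 i = sys_x0 \<Sigma> $ i"
    "\<And>i t. i < n \<Longrightarrow> t \<in> {0..1} \<Longrightarrow>
      ((\<lambda>t. x t i) has_real_derivative (\<Sum>j<n. a i j * x t j) + f t i) (at t within {0..1})"
    using linear_ode_solution_exists[OF E, of f "\<lambda>i. sys_x0 \<Sigma> $ i"] fc by blast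
  have "is_trajectory \<Sigma> u (\<lambda>t. Matrix.vec n (x t))"
    unfolding is_trajectory_def using A x0 x rhs by (auto intro!: eq_vecI)
  then have "(THE v. \<exists>x. is_trajectory \<Sigma> u x \<and> v = x 1) = w"
    using unique by (intro the_equality) auto
  then show ?thesis
    using C i by (simp add: final_output_def w_def scalar_prod_def atLeast0LessThan f_def)
qed


section \<open>The response of a linear system to exponential polynomials\<close>

text \<open>The complex inputs \<open>t\<^sup>l e\<^sup>\<mu>\<^sup>t\<close>; the basis inputs are real parts of multiples of these.\<close>

definition exppoly :: "complex \<Rightarrow> nat \<Rightarrow> real \<Rightarrow> complex" where
  "exppoly \<mu> l t = of_real t ^ l * exp (\<mu> * of_real t)"

text \<open>The \<open>(i, j)\<close> entry of \<open>\<integral>\<^sub>0\<^sup>1 E (1 - s) w(s) ds\<close>: the \<open>i\<close>-th coordinate at time \<open>1\<close> of the system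
  started at \<open>0\<close> and driven by \<open>w\<close> in the direction of the \<open>j\<close>-th unit vector.\<close>

definition response :: "(real \<Rightarrow> nat \<Rightarrow> nat \<Rightarrow> real) \<Rightarrow> (real \<Rightarrow> complex) \<Rightarrow> nat \<Rightarrow> nat \<Rightarrow> complex" where
  "response E w i j = integral {0..1} (\<lambda>s. of_real (E (1 - s) i j) * w s)"

lemma response_by_parts:
  assumes E: "fundamental n a E" and ij: "i < n" "j < n"
    and w: "\<And>t. t \<in> {0..1} \<Longrightarrow> (w has_vector_derivative w' t) (at t within {0..1})"
    and w': "continuous_on {0..1} w'"
  shows "(\<Sum>k<n. response E w i k * of_real (a k j)) =
    response E w' i j - (if i = j then w 1 else 0) + w 0 * of_real (E 1 i j)"
proof -
  have wc: "continuous_on {0..1} w" using w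
    by (meson continuous_on_eq_continuous_within has_vector_derivative_continuous)
  have Ec: "continuous_on {0..1} (\<lambda>s. complex_of_real (E (1 - s) i k))" if "k < n" for k
    using fundamental_reflected_continuous[OF E ij(1) that] by (intro continuous_intros)
  have intw: "(\<lambda>s. of_real (E (1 - s) i k) * w s) integrable_on {0..1}" if "k < n" for k
    by (intro integrable_continuous_real continuous_intros Ec wc that)
  have intw': "(\<lambda>s. of_real (E (1 - s) i j) * w' s) integrable_on {0..1}"
    by (intro integrable_continuous_real continuous_intros Ec w' ij)
  have "((\<lambda>s. of_real (E (1 - s) i j) * w s) has_vector_derivative
      of_real (E (1 - s) i j) * w' s + of_real (- (\<Sum>k<n. E (1 - s) i k * a k j)) * w s) (at s within {0..1})"
    if s: "s \<in> {0..1}" for s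
    by (intro has_vector_derivative_mult has_vector_derivative_of_real w s
        fundamental_deriv_reflected[OF E ij])
  then have "((\<lambda>s. of_real (E (1 - s) i j) * w' s + of_real (- (\<Sum>k<n. E (1 - s) i k * a k j)) * w s)
      has_integral of_real (E (1 - 1) i j) * w 1 - of_real (E (1 - 0) i j) * w 0) {0..1}"
    by (intro fundamental_theorem_of_calculus) auto
  moreover have "((\<lambda>s. of_real (E (1 - s) i j) * w' s + of_real (- (\<Sum>k<n. E (1 - s) i k * a k j)) * w s)
      has_integral response E w' i j - (\<Sum>k<n. response E w i k * of_real (a k j))) {0..1}"
  proof -
    have "((\<lambda>s. of_real (E (1 - s) i j) * w' s - (\<Sum>k<n. of_real (E (1 - s) i k) * w s * of_real (a k j)))
      has_integral response E w' i j - (\<Sum>k<n. response E w i k * of_real (a k j))) {0..1}"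
      unfolding response_def using intw intw'
      by (intro has_integral_diff has_integral_sum has_integral_mult_left integrable_integral) auto
    then show ?thesis by (simp add: sum_distrib_left sum_distrib_right mult_ac)
  qed
  ultimately have "of_real (E (1 - 1) i j) * w 1 - of_real (E (1 - 0) i j) * w 0 =
      response E w' i j - (\<Sum>k<n. response E w i k * of_real (a k j))"
    by (rule has_integral_unique)
  then show ?thesis using ij by (auto simp: fundamental_0[OF E] algebra_simps split: if_splits)
qed

lemma exppoly_deriv:
  "(exppoly \<mu> l has_vector_derivative (of_nat l * exppoly \<mu> (l - 1) t + \<mu> * exppoly \<mu> l t)) (at t within S)"
proof -
  have "((\<lambda>z. z ^ l * exp (\<mu> * z)) has_field_derivative
      (of_nat l * of_real t ^ (l - 1) * exp (\<mu> * of_real t) + of_real t ^ l * (\<mu> * exp (\<mu> * of_real t)))) (at (of_real t))"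
    by (auto intro!: derivative_eq_intros)
  from has_vector_derivative_real_field[OF this, of S] show ?thesis
    by (simp add: exppoly_def[abs_def] mult_ac)
qed

lemma exppoly_continuous: "continuous_on S (exppoly \<mu> l)"
  unfolding exppoly_def by (intro continuous_intros)

text \<open>The responses to \<open>t\<^sup>l e\<^sup>\<mu>\<^sup>t\<close> as one complex matrix, and the matrix \<open>a - \<mu>\<close> of the resolvent.\<close>

definition response_mat :: "nat \<Rightarrow> (real \<Rightarrow> nat \<Rightarrow> nat \<Rightarrow> real) \<Rightarrow> complex \<Rightarrow> nat \<Rightarrow> complex mat" where
  "response_mat n E \<mu> l = Matrix.mat n n (\<lambda>(i, j). response E (exppoly \<mu> l) i j)"

definition shifted_mat :: "nat \<Rightarrow> (nat \<Rightarrow> nat \<Rightarrow> real) \<Rightarrow> complex \<Rightarrow> complex mat" where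
  "shifted_mat n a \<mu> = Matrix.mat n n (\<lambda>(i, j). of_real (a i j) - (if i = j then \<mu> else 0))"

lemma response_mat_carrier [simp]: "response_mat n E \<mu> l \<in> carrier_mat n n"
  and shifted_mat_carrier [simp]: "shifted_mat n a \<mu> \<in> carrier_mat n n"
  by (simp_all add: response_mat_def shifted_mat_def)

text \<open>For \<open>l = 0\<close> the index \<open>l - 1\<close> is harmless, because the term carries the factor \<open>l\<close>.\<close>

lemma response_exppoly:
  assumes E: "fundamental n a E" and ij: "i < n" "j < n"
  shows "(\<Sum>k<n. response E (exppoly \<mu> l) i k * (of_real (a k j) - (if k = j then \<mu> else 0))) =
    of_nat l * response E (exppoly \<mu> (l - 1)) i j - (if i = j then exp \<mu> else 0)
      + (if l = 0 then of_real (E 1 i j) else 0)"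
proof -
  let ?w' = "\<lambda>t. of_nat l * exppoly \<mu> (l - 1) t + \<mu> * exppoly \<mu> l t"
  have Ec: "continuous_on {0..1} (\<lambda>s. complex_of_real (E (1 - s) i j))"
    using fundamental_reflected_continuous[OF E ij] by (intro continuous_intros)
  have int: "(\<lambda>s. of_real (E (1 - s) i j) * exppoly \<mu> q s) integrable_on {0..1}" for q
    by (intro integrable_continuous_real continuous_intros Ec exppoly_continuous)
  have "response E ?w' i j = integral {0..1} (\<lambda>s. of_nat l * (of_real (E (1 - s) i j) * exppoly \<mu> (l - 1) s)
      + \<mu> * (of_real (E (1 - s) i j) * exppoly \<mu> l s))"
    unfolding response_def by (simp add: algebra_simps)
  also have "\<dots> = of_nat l * response E (exppoly \<mu> (l - 1)) i j + \<mu> * response E (exppoly \<mu> l) i j"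
    unfolding response_def using int
    by (intro integral_unique has_integral_add has_integral_mult_right integrable_integral)
  finally have "(\<Sum>k<n. response E (exppoly \<mu> l) i k * of_real (a k j)) =
    of_nat l * response E (exppoly \<mu> (l - 1)) i j + \<mu> * response E (exppoly \<mu> l) i j
      - (if i = j then exppoly \<mu> l 1 else 0) + exppoly \<mu> l 0 * of_real (E 1 i j)"
    using response_by_parts[OF E ij, of "exppoly \<mu> l" ?w', OF exppoly_deriv] exppoly_continuous
    by (simp add: continuous_on_add continuous_on_mult)
  moreover have "(\<Sum>k<n. response E (exppoly \<mu> l) i k * (of_real (a k j) - (if k = j then \<mu> else 0))) =
      (\<Sum>k<n. response E (exppoly \<mu> l) i k * of_real (a k j)) - \<mu> * response E (exppoly \<mu> l) i j"
    using ij by (simp add: right_diff_distrib sum_subtractf if_distrib[of "\<lambda>x. _ * x"] cong: if_cong)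
  ultimately show ?thesis by (simp add: exppoly_def)
qed

text \<open>The numerators of the response matrix over the denominator \<open>det N\<^sup>l\<^sup>+\<^sup>1\<close>: \<open>num_free\<close> is the
  coefficient of \<open>E 1\<close>, and \<open>num_forced\<close> is the part that does not involve \<open>E 1\<close>.\<close>

fun num_free :: "complex mat \<Rightarrow> nat \<Rightarrow> complex mat" where
  "num_free N 0 = adj_mat N"
| "num_free N (Suc l) = of_nat (Suc l) \<cdot>\<^sub>m (num_free N l * adj_mat N)"

fun num_forced :: "complex \<Rightarrow> complex mat \<Rightarrow> nat \<Rightarrow> complex mat" where
  "num_forced \<mu> N 0 = (- exp \<mu>) \<cdot>\<^sub>m adj_mat N"
| "num_forced \<mu> N (Suc l) =
     of_nat (Suc l) \<cdot>\<^sub>m (num_forced \<mu> N l * adj_mat N) - (exp \<mu> * det N ^ Suc l) \<cdot>\<^sub>m adj_mat N"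

lemma num_carrier:
  assumes "N \<in> carrier_mat n n"
  shows "num_free N l \<in> carrier_mat n n" "num_forced \<mu> N l \<in> carrier_mat n n"
  using adj_mat(1)[OF assms] by (induction l) auto

text \<open>Multiplying the recursion in \<open>l\<close> from the right by the adjugate of \<open>N\<close> clears the denominators.
  Since \<open>E 1\<close> stays on the left, it need not commute with the adjugate.\<close>

lemma response_mat_closed_form:
  fixes \<mu> :: complex
  assumes E: "fundamental n a E"
  defines "N \<equiv> shifted_mat n a \<mu>" and "M \<equiv> Matrix.mat n n (\<lambda>(i, j). complex_of_real (E 1 i j))"
  shows "det N ^ Suc l \<cdot>\<^sub>m response_mat n E \<mu> l = M * num_free N l + num_forced \<mu> N l"
proof -
  have N: "N \<in> carrier_mat n n" and M: "M \<in> carrier_mat n n" by (simp_all add: N_def M_def)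
  note Z = adj_mat[OF N] and U = num_carrier(1)[OF N] and W = num_carrier(2)[OF N, of \<mu>]
  let ?Z = "adj_mat N" and ?K = "response_mat n E \<mu>"
  have K: "?K l \<in> carrier_mat n n" for l by simp
  have prod: "(?K l * N) $$ (i, j) = (\<Sum>k<n. response E (exppoly \<mu> l) i k * (of_real (a k j) - (if k = j then \<mu> else 0)))"
    if "i < n" "j < n" for i j l
    using that by (simp add: response_mat_def N_def shifted_mat_def scalar_prod_def atLeast0LessThan)
  have K0: "?K 0 * N = M - exp \<mu> \<cdot>\<^sub>m 1\<^sub>m n"
  proof (intro eq_matI)
    fix i j assume "i < dim_row (M - exp \<mu> \<cdot>\<^sub>m 1\<^sub>m n)" "j < dim_col (M - exp \<mu> \<cdot>\<^sub>m 1\<^sub>m n)"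
    then have ij: "i < n" "j < n" by (simp_all add: M_def)
    show "(?K 0 * N) $$ (i, j) = (M - exp \<mu> \<cdot>\<^sub>m 1\<^sub>m n) $$ (i, j)"
      unfolding prod[OF ij] response_exppoly[OF E ij] using ij by (simp add: M_def)
  qed (simp_all add: M_def N_def response_mat_def shifted_mat_def)
  have KS: "?K (Suc l) * N = of_nat (Suc l) \<cdot>\<^sub>m ?K l - exp \<mu> \<cdot>\<^sub>m 1\<^sub>m n" for l
  proof (intro eq_matI)
    fix i j assume "i < dim_row (of_nat (Suc l) \<cdot>\<^sub>m ?K l - exp \<mu> \<cdot>\<^sub>m 1\<^sub>m n)"
      "j < dim_col (of_nat (Suc l) \<cdot>\<^sub>m ?K l - exp \<mu> \<cdot>\<^sub>m 1\<^sub>m n)"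
    then have ij: "i < n" "j < n" by simp_all
    show "(?K (Suc l) * N) $$ (i, j) = (of_nat (Suc l) \<cdot>\<^sub>m ?K l - exp \<mu> \<cdot>\<^sub>m 1\<^sub>m n) $$ (i, j)"
      unfolding prod[OF ij] response_exppoly[OF E ij] using ij by (simp add: response_mat_def)
  qed (simp_all add: N_def response_mat_def shifted_mat_def)
  have KZ: "det N \<cdot>\<^sub>m ?K l = (?K l * N) * ?Z" for l
    using assoc_mult_mat[OF K N Z(1)] Z(2) mult_smult_distrib[OF K one_carrier_mat, of l "det N"]
      right_mult_one_mat[OF K] by simp
  show ?thesis
  proof (induction l)
    case 0
    have "det N \<cdot>\<^sub>m ?K 0 = M * ?Z - exp \<mu> \<cdot>\<^sub>m ?Z"
      unfolding KZ K0 using M Z(1)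
      by (simp add: minus_mult_distrib_mat[of _ n n] mult_smult_assoc_mat[of _ n n])
    also have "\<dots> = M * ?Z + (- exp \<mu>) \<cdot>\<^sub>m ?Z"
      using M Z(1) by (intro eq_matI) auto
    finally show ?case by simp
  next
    case (Suc l)
    have "det N ^ Suc (Suc l) \<cdot>\<^sub>m ?K (Suc l) = det N ^ Suc l \<cdot>\<^sub>m (det N \<cdot>\<^sub>m ?K (Suc l))"
      by (intro eq_matI) auto
    also have "\<dots> = det N ^ Suc l \<cdot>\<^sub>m (of_nat (Suc l) \<cdot>\<^sub>m (?K l * ?Z) - exp \<mu> \<cdot>\<^sub>m ?Z)"
      unfolding KZ KS using Z(1)
      by (simp add: minus_mult_distrib_mat[of _ n n] mult_smult_assoc_mat[of _ n n])
    also have "\<dots> = of_nat (Suc l) \<cdot>\<^sub>m ((det N ^ Suc l \<cdot>\<^sub>m ?K l) * ?Z) - (exp \<mu> * det N ^ Suc l) \<cdot>\<^sub>m ?Z"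
      using carrier_matD[OF Z(1)] carrier_matD[OF K]
      unfolding mult_smult_assoc_mat[OF K Z(1)] by (intro eq_matI) (auto simp: algebra_simps)
    also have "(det N ^ Suc l \<cdot>\<^sub>m ?K l) * ?Z = M * (num_free N l * ?Z) + num_forced \<mu> N l * ?Z"
      unfolding Suc.IH using M U W Z(1)
      by (simp add: add_mult_distrib_mat[of _ n n] assoc_mult_mat[of _ n n _ n _ n])
    also have "of_nat (Suc l) \<cdot>\<^sub>m (M * (num_free N l * ?Z) + num_forced \<mu> N l * ?Z) - (exp \<mu> * det N ^ Suc l) \<cdot>\<^sub>m ?Z
        = M * num_free N (Suc l) + num_forced \<mu> N (Suc l)"
    proof -
      have UZ: "num_free N l * ?Z \<in> carrier_mat n n" by (rule mult_carrier_mat[OF U Z(1)])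
      have WZ: "num_forced \<mu> N l * ?Z \<in> carrier_mat n n" by (rule mult_carrier_mat[OF W Z(1)])
      have regroup: "c \<cdot>\<^sub>m (P + Q) - R = c \<cdot>\<^sub>m P + (c \<cdot>\<^sub>m Q - R)"
        if "P \<in> carrier_mat n n" "Q \<in> carrier_mat n n" "R \<in> carrier_mat n n"
        for c :: complex and P Q R
        using that by (intro eq_matI) (auto simp: distrib_left)
      show ?thesis
        unfolding num_free.simps num_forced.simps mult_smult_distrib[OF M UZ]
        by (rule regroup[OF mult_carrier_mat[OF M UZ] WZ smult_carrier_mat[OF Z(1)]])
    qed
    finally show ?case .
  qed
qed


section \<open>Polynomial dependence on the entries\<close>

lemma polyfun_det:
  assumes "\<And>x. M x \<in> carrier_mat n n"
    and "\<And>i j. i < n \<Longrightarrow> j < n \<Longrightarrow> polyfun V D (\<lambda>x. M x $$ (i, j))"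
  shows "polyfun V (n * D) (\<lambda>x. det (M x))"
proof -
  have "polyfun V (n * D) (\<lambda>x. \<Prod>i = 0..<n. M x $$ (i, \<pi> i))" if "\<pi> permutes {0..<n}" for \<pi>
  proof -
    have "polyfun V (\<Sum>i = 0..<n. D) (\<lambda>x. \<Prod>i = 0..<n. M x $$ (i, \<pi> i))"
    proof (rule polyfun_prod)
      fix i assume "i \<in> {0..<n}"
      moreover from this have "\<pi> i < n" using permutes_in_image[OF that, of i] by simp
      ultimately show "polyfun V D (\<lambda>x. M x $$ (i, \<pi> i))" using assms(2) by simp
    qed
    then show ?thesis by simp
  qed
  then show ?thesis
    unfolding det_def'[OF assms(1)] by (intro polyfun_sum polyfun_scale) auto
qed

lemma polyfun_adj_mat:
  assumes M: "\<And>x. M x \<in> carrier_mat n n"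
    and p: "\<And>i j. i < n \<Longrightarrow> j < n \<Longrightarrow> polyfun V 1 (\<lambda>x. M x $$ (i, j))"
    and ij: "i < n" "j < n"
  shows "polyfun V n (\<lambda>x. adj_mat (M x) $$ (i, j))"
proof -
  have dims: "dim_row (M x) = n" "dim_col (M x) = n" for x using M[of x] by auto
  have "polyfun V ((n - 1) * 1) (\<lambda>x. det (mat_delete (M x) j i))"
    by (rule polyfun_det) (auto simp: mat_delete_def dims intro!: p[unfolded One_nat_def])
  then have "polyfun V n (\<lambda>x. (-1) ^ (j + i) * det (mat_delete (M x) j i))"
    by (intro polyfun_scale) (auto intro: polyfun_mono)
  then show ?thesis using ij by (simp add: adj_mat_def cofactor_def dims)
qed

lemma polyfun_mat_mult:
  assumes "\<And>x. M x \<in> carrier_mat n n" "\<And>x. M' x \<in> carrier_mat n n"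
    and "\<And>i j. i < n \<Longrightarrow> j < n \<Longrightarrow> polyfun V D (\<lambda>x. M x $$ (i, j))"
    and "\<And>i j. i < n \<Longrightarrow> j < n \<Longrightarrow> polyfun V D' (\<lambda>x. M' x $$ (i, j))"
    and "i < n" "j < n"
  shows "polyfun V (D + D') (\<lambda>x. (M x * M' x) $$ (i, j))"
proof -
  have "(M x * M' x) $$ (i, j) = (\<Sum>k = 0..<n. M x $$ (i, k) * M' x $$ (k, j))" for x
    using assms(1)[of x] assms(2)[of x] assms(5,6) by (auto simp: scalar_prod_def)
  then show ?thesis using assms by (auto intro!: polyfun_sum polyfun_mult)
qed

lemma
  assumes N: "\<And>x. N x \<in> carrier_mat n n"
    and p: "\<And>i j. i < n \<Longrightarrow> j < n \<Longrightarrow> polyfun V 1 (\<lambda>x. N x $$ (i, j))"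
  shows polyfun_num_free:
      "i < n \<Longrightarrow> j < n \<Longrightarrow> polyfun V (n * Suc l) (\<lambda>x. num_free (N x) l $$ (i, j))"
    and polyfun_num_forced:
      "i < n \<Longrightarrow> j < n \<Longrightarrow> polyfun V (n * Suc l) (\<lambda>x. num_forced \<mu> (N x) l $$ (i, j))"
proof (induction l arbitrary: i j)
  case 0
  note Z = adj_mat(1)[OF N]
  have dims: "dim_row (adj_mat (N x)) = n" "dim_col (adj_mat (N x)) = n" for x using Z[of x] by auto
  { case 1 then show ?case using polyfun_adj_mat[of N n V i j, OF N p] by simp }
  { case 2 then show ?case using polyfun_scale[OF polyfun_adj_mat[of N n V i j, OF N p], of "- exp \<mu>"]
      by (simp add: dims) }
next
  case (Suc l)
  note Z = adj_mat(1)[OF N] and U = num_carrier(1)[OF N] and W = num_carrier(2)[OF N, where \<mu> = \<mu>]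
  have dims: "dim_row (adj_mat (N x)) = n" "dim_col (adj_mat (N x)) = n" for x using Z[of x] by auto
  have dimUW: "dim_row (num_free (N x) l) = n" "dim_row (num_forced \<mu> (N x) l) = n" for x
    using U[of x l] W[of x l] by auto
  have pZ: "i < n \<Longrightarrow> j < n \<Longrightarrow> polyfun V n (\<lambda>x. adj_mat (N x) $$ (i, j))" for i j
    by (rule polyfun_adj_mat[OF N p])
  { case 1
    have "polyfun V (n * Suc l + n) (\<lambda>x. (num_free (N x) l * adj_mat (N x)) $$ (i, j))"
      by (rule polyfun_mat_mult[OF U Z Suc.IH(1) pZ 1])
    from polyfun_scale[OF this, of "of_nat (Suc l)"] show ?case
      using 1 by (simp add: dims dimUW add_ac) }
  { case 2
    have "polyfun V (n * Suc l + n) (\<lambda>x. (num_forced \<mu> (N x) l * adj_mat (N x)) $$ (i, j))"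
      by (rule polyfun_mat_mult[OF W Z Suc.IH(2) pZ 2])
    from polyfun_scale[OF this, of "of_nat (Suc l)"]
    have *: "polyfun V (n * Suc l + n) (\<lambda>x. of_nat (Suc l) * (num_forced \<mu> (N x) l * adj_mat (N x)) $$ (i, j))" .
    have "polyfun V (Suc l * (n * 1) + n) (\<lambda>x. det (N x) ^ Suc l * adj_mat (N x) $$ (i, j))"
      by (intro polyfun_mult polyfun_power polyfun_det N p pZ 2)
    from polyfun_diff[OF * polyfun_scale[OF polyfun_mono[OF this], of _ "exp \<mu>"]] show ?case
      using 2 by (simp add: dims dimUW add_ac mult.commute[of n] mult.assoc) }
qed


section \<open>Final outputs as polynomials in the parameters of the system\<close>

lemma basis_input_exppoly:
  assumes "basis_input l \<alpha> \<beta> w"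
  shows "\<exists>\<kappa>. \<forall>t\<in>{0..1}. w t = Re (\<kappa> * exppoly (Complex \<alpha> \<beta>) l t)"
proof -
  have e: "exppoly (Complex \<alpha> \<beta>) l t = of_real (t ^ l * exp (\<alpha> * t)) * cis (\<beta> * t)" for t
    by (simp add: exppoly_def exp_eq_polar of_real_power[symmetric] del: of_real_power)
  consider "\<forall>t\<in>{0..1}. w t = t ^ l * exp (\<alpha> * t) * sin (\<beta> * t)"
    | "\<forall>t\<in>{0..1}. w t = t ^ l * exp (\<alpha> * t) * cos (\<beta> * t)"
    using assms by (auto simp: basis_input_def)
  then show ?thesis
  proof cases
    case 1
    then show ?thesis by (intro exI[of _ "-\<i>"]) (simp add: e)
  next
    case 2
    then show ?thesis by (intro exI[of _ 1]) (simp add: e)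
  qed
qed

text \<open>Names for the independent variables: the entries of \<open>A\<close>, \<open>B\<close>, \<open>C\<close> and \<open>H = C (E 1)\<close>, and the
  entries of the vector \<open>C (E 1) x\<^sub>0\<close>.\<close>

datatype param = Par_A nat nat | Par_B nat nat | Par_C nat nat | Par_H nat nat | Par_c nat

text \<open>The variables for systems of dimension \<open>n\<close> with \<open>m\<close> inputs and \<open>p\<close> outputs.\<close>

definition params :: "nat \<Rightarrow> nat \<Rightarrow> nat \<Rightarrow> param set" where
  "params n m p = case_prod Par_A ` ({..<n} \<times> {..<n}) \<union> case_prod Par_B ` ({..<n} \<times> {..<m}) \<union>
     case_prod Par_C ` ({..<p} \<times> {..<n}) \<union> case_prod Par_H ` ({..<p} \<times> {..<n}) \<union> Par_c ` {..<p}"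

lemma params_mem [simp]:
  "Par_A i j \<in> params n m p \<longleftrightarrow> i < n \<and> j < n" "Par_B j r \<in> params n m p \<longleftrightarrow> j < n \<and> r < m"
  "Par_C i j \<in> params n m p \<longleftrightarrow> i < p \<and> j < n" "Par_H i j \<in> params n m p \<longleftrightarrow> i < p \<and> j < n"
  "Par_c i \<in> params n m p \<longleftrightarrow> i < p"
  by (auto simp: params_def)

lemma finite_params: "finite (params n m p)"
  by (simp add: params_def)

lemma card_params: "card (params n m p) \<le> n * n + n * m + p * n + p * n + p"
proof -
  have le: "card (f ` A) \<le> card A" if "finite A" for f :: "nat \<times> nat \<Rightarrow> param" and A
    using that by (rule card_image_le)
  have "card (params n m p) \<le> card (case_prod Par_A ` ({..<n} \<times> {..<n})) + card (case_prod Par_B ` ({..<n} \<times> {..<m}))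
     + card (case_prod Par_C ` ({..<p} \<times> {..<n})) + card (case_prod Par_H ` ({..<p} \<times> {..<n})) + card (Par_c ` {..<p})"
    unfolding params_def by (intro order_trans[OF card_Un_le] add_mono order_refl)
  also have "\<dots> \<le> n * n + n * m + p * n + p * n + p"
    using le[of "{..<n} \<times> {..<n}"] le[of "{..<n} \<times> {..<m}"] le[of "{..<p} \<times> {..<n}"] card_image_le[of "{..<p}" Par_c]
    by (intro add_mono) auto
  finally show ?thesis .
qed

text \<open>The \<open>q\<close>-th input function is \<open>Re (\<kappa> q * exppoly (\<mu> q) (l q) t)\<close>.\<close>

context
  fixes n m k :: nat and \<kappa> \<mu> :: "nat \<Rightarrow> complex" and l :: "nat \<Rightarrow> nat"
begin

text \<open>For the values \<open>\<theta>\<close> of the variables, \<open>res_mat\<close> is \<open>A - \<mu>\<^sub>q\<close>.  If it is invertible and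
  \<open>H = C (E 1)\<close>, then \<open>numer / denom\<close> is the \<open>i\<close>-th final output of the system, started at \<open>0\<close>, under
  the complex input \<open>exppoly (\<mu> q) (l q)\<close> in channel \<open>r\<close>.\<close>

definition res_mat :: "(param \<Rightarrow> real) \<Rightarrow> nat \<Rightarrow> complex mat" where
  "res_mat \<theta> q = shifted_mat n (\<lambda>i j. \<theta> (Par_A i j)) (\<mu> q)"

definition denom :: "(param \<Rightarrow> real) \<Rightarrow> nat \<Rightarrow> complex" where
  "denom \<theta> q = det (res_mat \<theta> q) ^ Suc (l q)"

definition numer :: "(param \<Rightarrow> real) \<Rightarrow> nat \<Rightarrow> nat \<Rightarrow> nat \<Rightarrow> complex" where
  "numer \<theta> i r q = (\<Sum>a<n. \<Sum>b<n.
     (of_real (\<theta> (Par_H i a)) * num_free (res_mat \<theta> q) (l q) $$ (a, b) +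
      of_real (\<theta> (Par_C i a)) * num_forced (\<mu> q) (res_mat \<theta> q) (l q) $$ (a, b)) * of_real (\<theta> (Par_B b r)))"

text \<open>The squared modulus of the denominator, written so that it is visibly polynomial.\<close>

definition denom_sq :: "(param \<Rightarrow> real) \<Rightarrow> nat \<Rightarrow> real" where
  "denom_sq \<theta> q = Re (denom \<theta> q * cnj (denom \<theta> q))"

text \<open>If the variables take the values that belong to a system, this is its \<open>i\<close>-th final output under
  the input with coefficient matrix \<open>G\<close>, multiplied by \<open>\<Prod>\<^sub>q denom_sq \<theta> q\<close>.\<close>

definition cleared_output :: "nat \<times> real mat \<Rightarrow> (param \<Rightarrow> real) \<Rightarrow> real" where
  "cleared_output = (\<lambda>(i, G) \<theta>. \<theta> (Par_c i) * (\<Prod>q<k. denom_sq \<theta> q) +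
     (\<Sum>r<m. \<Sum>q<k. G $$ (r, q) * (Re (\<kappa> q * (cnj (denom \<theta> q) * numer \<theta> i r q)) *
       (\<Prod>q'\<in>{..<k} - {q}. denom_sq \<theta> q'))))"

lemma res_mat_carrier: "res_mat \<theta> q \<in> carrier_mat n n"
  by (simp add: res_mat_def)

lemma polyfun_res_mat:
  assumes "i < n" "j < n"
  shows "polyfun (params n m p) 1 (\<lambda>\<theta>. res_mat \<theta> q $$ (i, j))"
proof -
  have "polyfun (params n m p) 1 (\<lambda>\<theta>. of_real (\<theta> (Par_A i j)) - (if i = j then \<mu> q else 0))"
    using assms by (intro polyfun_diff polyfun_var polyfun.const) simp
  then show ?thesis using assms by (simp add: res_mat_def shifted_mat_def)
qed

lemma polyfun_cleared_output:
  assumes l: "\<And>q. q < k \<Longrightarrow> l q \<le> lmax" and i: "i < p"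
  shows "polyfun (params n m p) (2 * n * k * Suc lmax + 2) (cleared_output (i, G))"
proof -
  let ?V = "params n m p"
  define L where "L = n * Suc lmax"
  have L: "n * Suc (l q) \<le> L" if "q < k" for q using l[OF that] by (simp add: L_def del: mult_Suc_right)
  have denom: "polyfun ?V L (\<lambda>\<theta>. denom \<theta> q)" if "q < k" for q
  proof -
    have "polyfun ?V (Suc (l q) * (n * 1)) (\<lambda>\<theta>. denom \<theta> q)"
      unfolding denom_def by (intro polyfun_power polyfun_det res_mat_carrier polyfun_res_mat)
    then show ?thesis by (rule polyfun_mono) (use L[OF that] in \<open>simp add: mult.commute\<close>)
  qed
  have denom_sq: "polyfun ?V (2 * L) (\<lambda>\<theta>. denom_sq \<theta> q)" if "q < k" for q
    unfolding denom_sq_def mult_2 by (intro polyfun_Re polyfun_mult polyfun_cnj denom that)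
  have numer: "polyfun ?V (L + 2) (\<lambda>\<theta>. numer \<theta> i r q)" if "r < m" "q < k" for r q
  proof -
    have "polyfun ?V ((1 + n * Suc (l q)) + 1) (\<lambda>\<theta>. numer \<theta> i r q)"
      unfolding numer_def
      by (intro polyfun_sum polyfun_mult polyfun.add polyfun_var polyfun_num_free polyfun_num_forced
          res_mat_carrier polyfun_res_mat) (use i that in auto)
    then show ?thesis by (rule polyfun_mono) (use L[OF that(2)] in simp)
  qed
  have "polyfun ?V (2 * L * k + 2) (\<lambda>\<theta>. \<theta> (Par_c i) * (\<Prod>q<k. denom_sq \<theta> q))"
  proof -
    have v: "polyfun ?V 1 (\<lambda>\<theta>. \<theta> (Par_c i))" using polyfun_var[of "Par_c i" ?V, where 'b = real] i by simp
    have "polyfun ?V (1 + (\<Sum>q<k. 2 * L)) (\<lambda>\<theta>. \<theta> (Par_c i) * (\<Prod>q<k. denom_sq \<theta> q))"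
      by (intro polyfun_mult v polyfun_prod denom_sq) auto
    then show ?thesis by (rule polyfun_mono) (simp add: mult.commute)
  qed
  moreover have "polyfun ?V (2 * L * k + 2) (\<lambda>\<theta>. G $$ (r, q) * (Re (\<kappa> q * (cnj (denom \<theta> q) * numer \<theta> i r q)) *
       (\<Prod>q'\<in>{..<k} - {q}. denom_sq \<theta> q')))" if rq: "r < m" "q < k" for r q
  proof -
    have "polyfun ?V ((L + (L + 2)) + (\<Sum>q'\<in>{..<k} - {q}. 2 * L))
      (\<lambda>\<theta>. G $$ (r, q) * (Re (\<kappa> q * (cnj (denom \<theta> q) * numer \<theta> i r q)) *
       (\<Prod>q'\<in>{..<k} - {q}. denom_sq \<theta> q')))"
      by (intro polyfun_scale[where c = "G $$ (r, q)"] polyfun_mult polyfun_Re polyfun_scale[where c = "\<kappa> q"]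
          polyfun_cnj denom numer polyfun_prod denom_sq rq) auto
    moreover obtain k' where "k = Suc k'" using rq by (cases k) auto
    ultimately show ?thesis using rq by (auto elim!: polyfun_mono simp: card_Diff_singleton algebra_simps)
  qed
  ultimately have "polyfun ?V (2 * L * k + 2) (cleared_output (i, G))"
    unfolding cleared_output_def prod.case by (intro polyfun.add polyfun_sum) auto
  then show ?thesis by (rule polyfun_mono) (simp add: L_def mult_ac del: mult_Suc_right)
qed

text \<open>The \<open>i\<close>-th final output of the system started at \<open>0\<close>, for the input and output matrices \<open>b\<close>
  and \<open>c\<close>.\<close>

definition forced_output ::
    "(real \<Rightarrow> nat \<Rightarrow> nat \<Rightarrow> real) \<Rightarrow> (nat \<Rightarrow> nat \<Rightarrow> real) \<Rightarrow> (nat \<Rightarrow> nat \<Rightarrow> real) \<Rightarrow> nat \<times> real mat \<Rightarrow> real" where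
  "forced_output E b c = (\<lambda>(i, G). \<Sum>r<m. \<Sum>q<k. G $$ (r, q) *
     Re (\<kappa> q * (\<Sum>a<n. \<Sum>j<n. of_real (c i a) * response E (exppoly (\<mu> q) (l q)) a j * of_real (b j r))))"

lemma cleared_output_eq:
  assumes E: "fundamental n (\<lambda>i j. \<theta> (Par_A i j)) E"
    and H: "\<And>i j. i < p \<Longrightarrow> j < n \<Longrightarrow> \<theta> (Par_H i j) = (\<Sum>a<n. \<theta> (Par_C i a) * E 1 a j)"
    and i: "i < p"
  shows "cleared_output (i, G) \<theta> = (\<Prod>q<k. denom_sq \<theta> q) *
    (\<theta> (Par_c i) + forced_output E (\<lambda>j r. \<theta> (Par_B j r)) (\<lambda>i a. \<theta> (Par_C i a)) (i, G))"
proof -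
  define R where "R q a j = response E (exppoly (\<mu> q) (l q)) a j" for q a j
  define T where "T r q = (\<Sum>a<n. \<Sum>j<n. of_real (\<theta> (Par_C i a)) * R q a j * of_real (\<theta> (Par_B j r)))" for r q
  have closed: "denom \<theta> q * R q a j = (\<Sum>e<n. of_real (E 1 a e) * num_free (res_mat \<theta> q) (l q) $$ (e, j))
      + num_forced (\<mu> q) (res_mat \<theta> q) (l q) $$ (a, j)" if "a < n" "j < n" for q a j
  proof -
    note car = num_carrier(1)[OF res_mat_carrier[of \<theta> q], of "l q"] num_carrier(2)[OF res_mat_carrier[of \<theta> q], where l = "l q" and \<mu> = "\<mu> q"]
    have "(denom \<theta> q \<cdot>\<^sub>m response_mat n E (\<mu> q) (l q)) $$ (a, j) =
      (Matrix.mat n n (\<lambda>(i, j). complex_of_real (E 1 i j)) * num_free (res_mat \<theta> q) (l q)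
        + num_forced (\<mu> q) (res_mat \<theta> q) (l q)) $$ (a, j)"
      unfolding denom_def res_mat_def response_mat_closed_form[OF E] ..
    then show ?thesis
      using that carrier_matD[OF car(1)] carrier_matD[OF car(2)]
      by (simp add: response_mat_def R_def scalar_prod_def atLeast0LessThan)
  qed
  have numer: "numer \<theta> i r q = denom \<theta> q * T r q" for r q
  proof -
    have "denom \<theta> q * T r q = (\<Sum>a<n. \<Sum>j<n. of_real (\<theta> (Par_C i a)) * (denom \<theta> q * R q a j) * of_real (\<theta> (Par_B j r)))"
      by (simp add: T_def sum_distrib_left mult_ac)
    also have "\<dots> = (\<Sum>a<n. \<Sum>j<n. (\<Sum>e<n. of_real (\<theta> (Par_C i a)) * of_real (E 1 a e) * num_free (res_mat \<theta> q) (l q) $$ (e, j))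
        * of_real (\<theta> (Par_B j r)) + of_real (\<theta> (Par_C i a)) * num_forced (\<mu> q) (res_mat \<theta> q) (l q) $$ (a, j) * of_real (\<theta> (Par_B j r)))"
      by (intro sum.cong refl) (simp add: closed distrib_left distrib_right sum_distrib_left mult.assoc)
    also have "\<dots> = (\<Sum>j<n. \<Sum>a<n. \<Sum>e<n. of_real (\<theta> (Par_C i a)) * of_real (E 1 a e) * num_free (res_mat \<theta> q) (l q) $$ (e, j)
        * of_real (\<theta> (Par_B j r))) + (\<Sum>a<n. \<Sum>j<n. of_real (\<theta> (Par_C i a)) * num_forced (\<mu> q) (res_mat \<theta> q) (l q) $$ (a, j) * of_real (\<theta> (Par_B j r)))"
      by (simp add: sum.distrib sum_distrib_right) (rule sum.swap)
    also have "(\<Sum>j<n. \<Sum>a<n. \<Sum>e<n. of_real (\<theta> (Par_C i a)) * of_real (E 1 a e) * num_free (res_mat \<theta> q) (l q) $$ (e, j)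
        * of_real (\<theta> (Par_B j r))) = (\<Sum>j<n. \<Sum>e<n. \<Sum>a<n. of_real (\<theta> (Par_C i a)) * of_real (E 1 a e) * num_free (res_mat \<theta> q) (l q) $$ (e, j)
        * of_real (\<theta> (Par_B j r)))"
      by (intro sum.cong refl sum.swap)
    also have "\<dots> = (\<Sum>j<n. \<Sum>e<n. of_real (\<theta> (Par_H i e)) * num_free (res_mat \<theta> q) (l q) $$ (e, j) * of_real (\<theta> (Par_B j r)))"
      by (intro sum.cong refl) (simp add: H[OF i] sum_distrib_right)
    also have "\<dots> = (\<Sum>e<n. \<Sum>j<n. of_real (\<theta> (Par_H i e)) * num_free (res_mat \<theta> q) (l q) $$ (e, j) * of_real (\<theta> (Par_B j r)))"
      by (rule sum.swap)
    finally show ?thesis by (simp add: numer_def distrib_right sum.distrib)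
  qed
  have cancel: "Re (\<kappa> q * (cnj (denom \<theta> q) * numer \<theta> i r q)) = denom_sq \<theta> q * Re (\<kappa> q * T r q)" for r q
  proof -
    have "\<kappa> q * (cnj (denom \<theta> q) * numer \<theta> i r q) = (denom \<theta> q * cnj (denom \<theta> q)) * (\<kappa> q * T r q)"
      by (simp add: numer mult_ac)
    also have "\<dots> = of_real (denom_sq \<theta> q) * (\<kappa> q * T r q)"
      by (simp add: denom_sq_def complex_mult_cnj)
    finally have "\<kappa> q * (cnj (denom \<theta> q) * numer \<theta> i r q) = of_real (denom_sq \<theta> q) * (\<kappa> q * T r q)" .
    then show ?thesis by (simp only:) (simp add: algebra_simps)
  qed
  have "G $$ (r, q) * (Re (\<kappa> q * (cnj (denom \<theta> q) * numer \<theta> i r q)) * (\<Prod>q'\<in>{..<k} - {q}. denom_sq \<theta> q'))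
      = (\<Prod>q<k. denom_sq \<theta> q) * (G $$ (r, q) * Re (\<kappa> q * T r q))" if "q < k" for r q
    using that unfolding cancel by (subst prod.remove[of "{..<k}" q]) (auto simp: mult_ac)
  then show ?thesis
    by (simp add: cleared_output_def forced_output_def T_def R_def distrib_left sum_distrib_left mult.commute[of "\<theta> (Par_c i)"])
qed

lemma denom_sq_pos: "det (res_mat \<theta> q) \<noteq> 0 \<Longrightarrow> denom_sq \<theta> q > 0"
proof -
  assume "det (res_mat \<theta> q) \<noteq> 0"
  then have "denom \<theta> q \<noteq> 0" by (simp add: denom_def)
  then show ?thesis by (auto simp: denom_sq_def complex_eq_iff sum_squares_gt_zero_iff)
qed

lemma final_output_eq:
  assumes \<Sigma>: "\<Sigma> \<in> linear_systems n m p"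
    and E: "fundamental n (\<lambda>i j. sys_A \<Sigma> $$ (i, j)) E"
    and w: "\<And>q t. q < k \<Longrightarrow> t \<in> {0..1} \<Longrightarrow> w q t = Re (\<kappa> q * exppoly (\<mu> q) (l q) t)"
    and G: "G \<in> carrier_mat m k" and i: "i < p"
  shows "final_output \<Sigma> (\<lambda>t\<in>{0..1}. G *\<^sub>v Matrix.vec k (\<lambda>j. w j t)) $ i =
    (\<Sum>a<n. sys_C \<Sigma> $$ (i, a) * (\<Sum>b<n. E 1 a b * sys_x0 \<Sigma> $ b)) +
    forced_output E (\<lambda>j r. sys_B \<Sigma> $$ (j, r)) (\<lambda>i a. sys_C \<Sigma> $$ (i, a)) (i, G)"
proof -
  define u where "u = (\<lambda>t\<in>{0..1}. G *\<^sub>v Matrix.vec k (\<lambda>j. w j t))"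
  define R where "R q a j = response E (exppoly (\<mu> q) (l q)) a j" for q a j
  have u: "u t $ r = (\<Sum>q<k. G $$ (r, q) * Re (\<kappa> q * exppoly (\<mu> q) (l q) t))" if "r < m" "t \<in> {0..1}" for r t
    using that G w by (simp add: u_def scalar_prod_def atLeast0LessThan)
  have uc: "continuous_on {0..1} (\<lambda>t. u t $ r)" if "r < m" for r
  proof -
    have "continuous_on {0..1} (\<lambda>t. \<Sum>q<k. G $$ (r, q) * Re (\<kappa> q * exppoly (\<mu> q) (l q) t))"
      by (intro continuous_intros exppoly_continuous)
    then show ?thesis by (rule continuous_on_eq) (rule u[OF that, symmetric])
  qed
  have int: "((\<lambda>s. E (1 - s) a b * Re (\<kappa> q * exppoly (\<mu> q) (l q) s)) has_integral Re (\<kappa> q * R q a b)) {0..1}"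
    if "a < n" "b < n" for a b q
  proof -
    have "continuous_on {0..1} (\<lambda>s. complex_of_real (E (1 - s) a b))"
      using fundamental_reflected_continuous[OF E that] by (intro continuous_intros)
    then have "(\<lambda>s. of_real (E (1 - s) a b) * exppoly (\<mu> q) (l q) s) integrable_on {0..1}"
      by (intro integrable_continuous_real continuous_on_mult exppoly_continuous)
    from has_integral_Re[OF has_integral_mult_right[OF integrable_integral[OF this], of "\<kappa> q"]]
    show ?thesis unfolding R_def response_def by (simp add: algebra_simps)
  qed
  have inner: "integral {0..1} (\<lambda>s. \<Sum>b<n. E (1 - s) a b * (\<Sum>r<m. sys_B \<Sigma> $$ (b, r) * u s $ r)) =
    (\<Sum>b<n. \<Sum>r<m. \<Sum>q<k. sys_B \<Sigma> $$ (b, r) * (G $$ (r, q) * Re (\<kappa> q * R q a b)))" if a: "a < n" for a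
  proof -
    have "((\<lambda>s. \<Sum>b<n. \<Sum>r<m. \<Sum>q<k. sys_B \<Sigma> $$ (b, r) * (G $$ (r, q) * (E (1 - s) a b * Re (\<kappa> q * exppoly (\<mu> q) (l q) s))))
      has_integral (\<Sum>b<n. \<Sum>r<m. \<Sum>q<k. sys_B \<Sigma> $$ (b, r) * (G $$ (r, q) * Re (\<kappa> q * R q a b)))) {0..1}"
      by (intro has_integral_sum has_integral_mult_right int a) auto
    moreover have "(\<Sum>b<n. \<Sum>r<m. \<Sum>q<k. sys_B \<Sigma> $$ (b, r) * (G $$ (r, q) * (E (1 - s) a b * Re (\<kappa> q * exppoly (\<mu> q) (l q) s))))
      = (\<Sum>b<n. E (1 - s) a b * (\<Sum>r<m. sys_B \<Sigma> $$ (b, r) * u s $ r))" if "s \<in> {0..1}" for s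
      using that by (simp add: u sum_distrib_left algebra_simps)
    ultimately show ?thesis
      by (intro integral_unique) (rule has_integral_eq, auto)
  qed
  have "final_output \<Sigma> u $ i = (\<Sum>a<n. sys_C \<Sigma> $$ (i, a) *
    ((\<Sum>b<n. E 1 a b * sys_x0 \<Sigma> $ b) +
     integral {0..1} (\<lambda>s. \<Sum>b<n. E (1 - s) a b * (\<Sum>r<m. sys_B \<Sigma> $$ (b, r) * u s $ r))))"
    by (rule final_output_formula[OF \<Sigma> E _ uc i]) (use G in \<open>auto simp: u_def\<close>)
  also have "\<dots> = (\<Sum>a<n. sys_C \<Sigma> $$ (i, a) * (\<Sum>b<n. E 1 a b * sys_x0 \<Sigma> $ b)) +
      (\<Sum>a<n. \<Sum>b<n. \<Sum>r<m. \<Sum>q<k. sys_C \<Sigma> $$ (i, a) * (sys_B \<Sigma> $$ (b, r) * (G $$ (r, q) * Re (\<kappa> q * R q a b))))"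
  proof -
    have "(\<Sum>a<n. sys_C \<Sigma> $$ (i, a) * ((\<Sum>b<n. E 1 a b * sys_x0 \<Sigma> $ b) +
        integral {0..1} (\<lambda>s. \<Sum>b<n. E (1 - s) a b * (\<Sum>r<m. sys_B \<Sigma> $$ (b, r) * u s $ r)))) =
      (\<Sum>a<n. sys_C \<Sigma> $$ (i, a) * ((\<Sum>b<n. E 1 a b * sys_x0 \<Sigma> $ b) +
        (\<Sum>b<n. \<Sum>r<m. \<Sum>q<k. sys_B \<Sigma> $$ (b, r) * (G $$ (r, q) * Re (\<kappa> q * R q a b)))))"
      by (intro sum.cong refl) (simp only: inner lessThan_iff)
    then show ?thesis by (simp only: distrib_left sum.distrib sum_distrib_left)
  qed
  also have "(\<Sum>a<n. \<Sum>b<n. \<Sum>r<m. \<Sum>q<k. sys_C \<Sigma> $$ (i, a) * (sys_B \<Sigma> $$ (b, r) * (G $$ (r, q) * Re (\<kappa> q * R q a b))))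
    = (\<Sum>r<m. \<Sum>q<k. \<Sum>a<n. \<Sum>b<n. sys_C \<Sigma> $$ (i, a) * (sys_B \<Sigma> $$ (b, r) * (G $$ (r, q) * Re (\<kappa> q * R q a b))))"
    by (simp only: sum.cartesian_product, rule sum.reindex_bij_witness[of _
        "\<lambda>(r, q, a, b). (a, b, r, q)" "\<lambda>(a, b, r, q). (r, q, a, b)"]) auto
  also have "\<dots> = forced_output E (\<lambda>j r. sys_B \<Sigma> $$ (j, r)) (\<lambda>i a. sys_C \<Sigma> $$ (i, a)) (i, G)"
    unfolding forced_output_def prod.case R_def[symmetric]
    by (intro sum.cong refl) (simp add: sum_distrib_left algebra_simps)
  finally show ?thesis unfolding u_def .
qed

lemma response_shift_continuous:
  assumes E: "fundamental n a E" and ij: "i < n" "j < n" and w: "continuous_on {0..1} w"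
  shows "continuous_on UNIV (\<lambda>\<epsilon>. response (\<lambda>t i j. exp (\<epsilon> * t) * E t i j) w i j)"
proof -
  have "continuous_on (UNIV \<times> cbox 0 1) (\<lambda>(\<epsilon>, s). of_real (exp (\<epsilon> * (1 - s)) * E (1 - s) i j) * w s)"
    unfolding split_beta
    by (intro continuous_intros continuous_on_compose2[OF fundamental_continuous[OF E ij, of UNIV], of _ "\<lambda>x. 1 - snd x"]
        continuous_on_compose2[OF w, of _ snd]) auto
  from integral_continuous_on_param[OF this] show ?thesis by (simp add: response_def)
qed

text \<open>The shifted matrix is singular only if \<open>z - \<epsilon>\<close> is an eigenvalue.\<close>

lemma finite_singular_shifts: "finite {\<epsilon>. det (shifted_mat n (\<lambda>i j. a i j + (if i = j then \<epsilon> else 0)) z) = 0}"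
proof -
  define A where "A = Matrix.mat n n (\<lambda>(i, j). complex_of_real (a i j))"
  have A: "A \<in> carrier_mat n n" by (simp add: A_def)
  have "shifted_mat n (\<lambda>i j. a i j + (if i = j then \<epsilon> else 0)) z = char_matrix A (z - of_real \<epsilon>)" for \<epsilon>
    by (intro eq_matI) (auto simp: shifted_mat_def char_matrix_def A_def)
  then have "{\<epsilon>. det (shifted_mat n (\<lambda>i j. a i j + (if i = j then \<epsilon> else 0)) z) = 0}
      = (\<lambda>\<epsilon>. z - of_real \<epsilon>) -` {x. poly (char_poly A) x = 0}"
    using eigenvalue_root_char_poly[OF A] eigenvalue_det[OF A] by auto
  moreover have "finite {x. poly (char_poly A) x = 0}"
    using degree_monic_char_poly[OF A] by (intro poly_roots_finite) auto
  moreover have "inj (\<lambda>\<epsilon>. z - complex_of_real \<epsilon>)" by (auto simp: inj_on_def)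
  ultimately show ?thesis by (simp only: finite_vimageI)
qed

text \<open>At a suitable common point \<open>\<theta>\<close>, the polynomials that belong to finitely many final outputs of a
  system are positive for the positive outputs and negative for all others, zero included.  The point need not come from
  the system itself: it belongs to the matrix \<open>A + \<epsilon>\<close>, and its constant terms are lowered by \<open>\<eta>\<close>.\<close>

lemma sign_sample:
  assumes \<Sigma>: "\<Sigma> \<in> linear_systems n m p"
    and w: "\<And>q t. q < k \<Longrightarrow> t \<in> {0..1} \<Longrightarrow> w q t = Re (\<kappa> q * exppoly (\<mu> q) (l q) t)"
    and Y: "finite Y" "Y \<subseteq> {..<p} \<times> carrier_mat m k"
  shows "\<exists>\<theta>. \<forall>(i, G)\<in>Y. cleared_output (i, G) \<theta> \<noteq> 0 \<and> (cleared_output (i, G) \<theta> > 0 \<longleftrightarrow>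
    final_output \<Sigma> (\<lambda>t\<in>{0..1}. G *\<^sub>v Matrix.vec k (\<lambda>j. w j t)) $ i > 0)"
proof -
  define a b c where "a = (\<lambda>i j. sys_A \<Sigma> $$ (i, j))" and "b = (\<lambda>j r. sys_B \<Sigma> $$ (j, r))"
    and "c = (\<lambda>i j. sys_C \<Sigma> $$ (i, j))"
  obtain E where E: "fundamental n a E" using fundamental_exists by blast
  define E' where "E' \<epsilon> = (\<lambda>t i j. exp (\<epsilon> * t) * E t i j)" for \<epsilon>
  define free where "free \<epsilon> i = (\<Sum>d<n. c i d * (\<Sum>j<n. E' \<epsilon> 1 d j * sys_x0 \<Sigma> $ j))" for \<epsilon> i
  define y where "y \<epsilon> x = free \<epsilon> (fst x) + forced_output (E' \<epsilon>) b c x" for \<epsilon> x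
  have E'0: "E' 0 = E" by (simp add: E'_def)
  have y0: "final_output \<Sigma> (\<lambda>t\<in>{0..1}. G *\<^sub>v Matrix.vec k (\<lambda>j. w j t)) $ i = y 0 (i, G)"
    if "(i, G) \<in> Y" for i G
    using final_output_eq[OF \<Sigma> E[unfolded a_def] w, of G i] that Y(2)
    by (auto simp: y_def free_def E'0 b_def c_def)
  have cont: "continuous_on UNIV (\<lambda>\<epsilon>. y \<epsilon> x)" for x
  proof -
    have r: "continuous_on UNIV (\<lambda>\<epsilon>. response (E' \<epsilon>) (exppoly (\<mu> q) (l q)) d j)" if "d < n" "j < n" for q d j
      unfolding E'_def by (rule response_shift_continuous[OF E that exppoly_continuous])
    show ?thesis
      unfolding y_def free_def forced_output_def split_beta
      by (intro continuous_intros r) (auto simp: E'_def intro!: continuous_intros)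
  qed
  \<comment> \<open>Any \<open>\<eta>\<close> between \<open>0\<close> and the smallest positive output separates positive outputs from the rest.\<close>
  define \<eta> where "\<eta> = Min (insert 1 ((\<lambda>x. y 0 x / 2) ` {x \<in> Y. y 0 x > 0}))"
  have \<eta>0: "\<eta> > 0" unfolding \<eta>_def using Y(1) by (subst Min_gr_iff) auto
  have \<eta>1: "\<eta> < y 0 x" if "x \<in> Y" "y 0 x > 0" for x
  proof -
    have "\<eta> \<le> y 0 x / 2" unfolding \<eta>_def using Y(1) that by (intro Min_le) auto
    then show ?thesis using that(2) by linarith
  qed
  have \<eta>: "y 0 x \<noteq> \<eta> \<and> (\<eta> < y 0 x \<longleftrightarrow> 0 < y 0 x)" if "x \<in> Y" for x
    using \<eta>0 \<eta>1[OF that] by (cases "y 0 x > 0") auto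
  have "\<forall>\<^sub>F \<epsilon> in at 0. y \<epsilon> x \<noteq> \<eta> \<and> (\<eta> < y \<epsilon> x \<longleftrightarrow> 0 < y 0 x)" if x: "x \<in> Y" for x
  proof -
    have lim: "((\<lambda>\<epsilon>. y \<epsilon> x) \<longlongrightarrow> y 0 x) (at 0)"
      using cont[of x] by (simp add: continuous_on_def)
    show ?thesis
    proof (cases "y 0 x > 0")
      case True
      then have "\<eta> < y 0 x" using \<eta>[OF x] by simp
      from order_tendstoD(1)[OF lim this] show ?thesis by eventually_elim (use True in auto)
    next
      case False
      then have "y 0 x < \<eta>" using \<eta>[OF x] by auto
      from order_tendstoD(2)[OF lim this] show ?thesis by eventually_elim (use False in auto)
    qed
  qed
  then have "\<forall>\<^sub>F \<epsilon> in at 0. \<forall>x\<in>Y. y \<epsilon> x \<noteq> \<eta> \<and> (\<eta> < y \<epsilon> x \<longleftrightarrow> 0 < y 0 x)"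
    by (intro eventually_ball_finite Y(1)) auto
  moreover have "\<forall>\<^sub>F \<epsilon> in at 0. \<forall>q\<in>{..<k}. det (shifted_mat n (\<lambda>i j. a i j + (if i = j then \<epsilon> else 0)) (\<mu> q)) \<noteq> 0"
  proof (intro eventually_ball_finite ballI)
    fix q
    let ?B = "{\<epsilon>. det (shifted_mat n (\<lambda>i j. a i j + (if i = j then \<epsilon> else 0)) (\<mu> q)) = 0}"
    have "open (- (?B - {0}))"
      by (intro open_Compl finite_imp_closed finite_Diff finite_singular_shifts)
    then have "\<forall>\<^sub>F \<epsilon> in at 0. \<epsilon> \<in> - (?B - {0}) - {0}"
      by (rule eventually_at_in_open) simp
    then show "\<forall>\<^sub>F \<epsilon> in at 0. det (shifted_mat n (\<lambda>i j. a i j + (if i = j then \<epsilon> else 0)) (\<mu> q)) \<noteq> 0"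
      by eventually_elim auto
  qed simp
  ultimately have "\<forall>\<^sub>F \<epsilon> in at (0::real). (\<forall>x\<in>Y. y \<epsilon> x \<noteq> \<eta> \<and> (\<eta> < y \<epsilon> x \<longleftrightarrow> 0 < y 0 x)) \<and>
      (\<forall>q\<in>{..<k}. det (shifted_mat n (\<lambda>i j. a i j + (if i = j then \<epsilon> else 0)) (\<mu> q)) \<noteq> 0)"
    by (rule eventually_conj)
  from eventually_happens'[OF at_neq_bot this] obtain \<epsilon>
    where sgn: "\<forall>x\<in>Y. y \<epsilon> x \<noteq> \<eta> \<and> (\<eta> < y \<epsilon> x \<longleftrightarrow> 0 < y 0 x)"
    and nz: "\<forall>q\<in>{..<k}. det (shifted_mat n (\<lambda>i j. a i j + (if i = j then \<epsilon> else 0)) (\<mu> q)) \<noteq> 0"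
    by (elim exE conjE)
  define \<theta> where "\<theta> v = (case v of Par_A i j \<Rightarrow> a i j + (if i = j then \<epsilon> else 0) | Par_B j r \<Rightarrow> b j r
    | Par_C i j \<Rightarrow> c i j | Par_H i j \<Rightarrow> (\<Sum>d<n. c i d * E' \<epsilon> 1 d j) | Par_c i \<Rightarrow> free \<epsilon> i - \<eta>)" for v
  have \<theta>: "\<theta> (Par_A i j) = a i j + (if i = j then \<epsilon> else 0)" "\<theta> (Par_B i j) = b i j" "\<theta> (Par_C i j) = c i j"
    "\<theta> (Par_H i j) = (\<Sum>d<n. c i d * E' \<epsilon> 1 d j)" "\<theta> (Par_c i) = free \<epsilon> i - \<eta>" for i j
    by (simp_all add: \<theta>_def)
  have E\<epsilon>: "fundamental n (\<lambda>i j. \<theta> (Par_A i j)) (E' \<epsilon>)"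
    unfolding \<theta> E'_def by (rule fundamental_shift[OF E])
  have "denom_sq \<theta> q > 0" if "q < k" for q
    using nz that by (intro denom_sq_pos) (simp add: res_mat_def \<theta>)
  then have pos: "(\<Prod>q<k. denom_sq \<theta> q) > 0" by (intro prod_pos) auto
  have "cleared_output (i, G) \<theta> = (\<Prod>q<k. denom_sq \<theta> q) * (y \<epsilon> (i, G) - \<eta>)" if "(i, G) \<in> Y" for i G
    using cleared_output_eq[OF E\<epsilon>, of p i G] that Y(2) by (auto simp: \<theta> y_def algebra_simps)
  then show ?thesis
    using sgn pos y0 by (intro exI[of _ \<theta>]) (auto simp: zero_less_mult_iff split_beta simp del: prod_zero_iff)
qed

section \<open>Shattered sets\<close>

text \<open>The sets \<open>S \<subseteq> D\<close> are realised by systems \<open>\<Sigma> S\<close> whose output signs differ, so they give \<open>2\<^bsup>card D\<^esup>\<close>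
  points in different sign cells of at most \<open>p * card D\<close> polynomials.\<close>

lemma shattered_card_bound:
  assumes w: "\<And>q t. q < k \<Longrightarrow> t \<in> {0..1} \<Longrightarrow> w q t = Re (\<kappa> q * exppoly (\<mu> q) (l q) t)"
    and l: "\<And>q. q < k \<Longrightarrow> l q \<le> lmax"
    and D: "finite D" "D \<subseteq> input_space m k w \<times> A"
    and sh: "shatters (loss01 ` sign_system_class n m p k w) D"
  shows "2 ^ card D \<le>
    Suc (2 * ((p * card D) * (2 * n * k * Suc lmax + 2))) ^ (n * n + n * m + p * n + p * n + p)"
proof -
  define u where "u G = (\<lambda>t\<in>{0..1}. G *\<^sub>v Matrix.vec k (\<lambda>j. w j t))" for G :: "real mat"
  have "\<forall>S. \<exists>\<Sigma>. \<Sigma> \<in> linear_systems n m p \<and> (\<forall>z b. (z, b) \<in> D \<longrightarrow> (bits_to_nat (sign_output \<Sigma> z) \<noteq> b \<longleftrightarrow> (z, b) \<in> S))"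
  proof
    fix S
    define g :: "(real \<Rightarrow> real Matrix.vec) \<times> nat \<Rightarrow> nat" where "g d = (if d \<in> S then 1 else 0)" for d
    have "\<exists>h\<in>loss01 ` sign_system_class n m p k w. \<forall>d\<in>D. h d = g d"
      using sh[unfolded shatters_def, rule_format, of g] by (simp add: g_def)
    then obtain \<Sigma> where "\<Sigma> \<in> linear_systems n m p"
      and eq: "\<And>d. d \<in> D \<Longrightarrow> loss01 (\<lambda>u\<in>input_space m k w. bits_to_nat (sign_output \<Sigma> u)) d = g d"
      unfolding sign_system_class_def by blast
    moreover have "bits_to_nat (sign_output \<Sigma> z) \<noteq> b \<longleftrightarrow> (z, b) \<in> S" if "(z, b) \<in> D" for z b
      using eq[OF that] that D(2) by (auto simp: loss01_def g_def split: if_splits)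
    ultimately show "\<exists>\<Sigma>. \<Sigma> \<in> linear_systems n m p \<and> (\<forall>z b. (z, b) \<in> D \<longrightarrow> (bits_to_nat (sign_output \<Sigma> z) \<noteq> b \<longleftrightarrow> (z, b) \<in> S))"
      by blast
  qed
  from choice[OF this] obtain \<Sigma> where
    "\<forall>S. \<Sigma> S \<in> linear_systems n m p \<and> (\<forall>z b. (z, b) \<in> D \<longrightarrow> (bits_to_nat (sign_output (\<Sigma> S) z) \<noteq> b \<longleftrightarrow> (z, b) \<in> S))"
    by (elim exE)
  then have \<Sigma>: "\<Sigma> S \<in> linear_systems n m p"
    and real_S: "(z, b) \<in> D \<Longrightarrow> bits_to_nat (sign_output (\<Sigma> S) z) \<noteq> b \<longleftrightarrow> (z, b) \<in> S" for S z b
    by blast+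
  have "\<forall>z\<in>fst ` D. \<exists>G. G \<in> carrier_mat m k \<and> z = u G"
  proof
    fix z assume "z \<in> fst ` D"
    then have "z \<in> input_space m k w" using D(2) by auto
    then show "\<exists>G. G \<in> carrier_mat m k \<and> z = u G" by (auto simp: input_space_def u_def)
  qed
  then obtain \<gamma> where \<gamma>: "\<And>z. z \<in> fst ` D \<Longrightarrow> \<gamma> z \<in> carrier_mat m k \<and> z = u (\<gamma> z)" by metis
  define Y where "Y = {..<p} \<times> \<gamma> ` fst ` D"
  have Y: "finite Y" "Y \<subseteq> {..<p} \<times> carrier_mat m k" using D(1) \<gamma> by (auto simp: Y_def)
  have cardY: "card Y \<le> p * card D"
    unfolding Y_def card_cartesian_product
    using card_image_le[OF D(1), of fst] card_image_le[of "fst ` D" \<gamma>] D(1) by (auto intro!: mult_left_mono)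
  have "\<forall>S. \<exists>\<theta>. \<forall>(i, G)\<in>Y. cleared_output (i, G) \<theta> \<noteq> 0 \<and>
      (cleared_output (i, G) \<theta> > 0 \<longleftrightarrow> final_output (\<Sigma> S) (u G) $ i > 0)"
    unfolding u_def by (intro allI sign_sample[OF \<Sigma> w Y])
  from choice[OF this] obtain \<theta> where \<theta>: "\<forall>S. \<forall>(i, G)\<in>Y. cleared_output (i, G) (\<theta> S) \<noteq> 0 \<and>
      (cleared_output (i, G) (\<theta> S) > 0 \<longleftrightarrow> final_output (\<Sigma> S) (u G) $ i > 0)"
    by (elim exE)
  then have nz: "cleared_output x (\<theta> S) \<noteq> 0" if "x \<in> Y" for S x
    using that by (cases x) blast
  have sgn: "cleared_output (i, G) (\<theta> S) > 0 \<longleftrightarrow> final_output (\<Sigma> S) (u G) $ i > 0" if "(i, G) \<in> Y" for S i G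
    using \<theta> that by blast
  have sep: "\<exists>x\<in>Y. cleared_output x (\<theta> S) * cleared_output x (\<theta> S') < 0"
    if S: "S \<subseteq> D" "S' \<subseteq> D" "S \<noteq> S'" for S S'
  proof -
    obtain z b where zb: "(z, b) \<in> D" "(z, b) \<in> S \<longleftrightarrow> (z, b) \<notin> S'" using S by auto
    then have "bits_to_nat (sign_output (\<Sigma> S) z) \<noteq> bits_to_nat (sign_output (\<Sigma> S') z)"
      using real_S[OF zb(1), of S] real_S[OF zb(1), of S'] by auto
    then have neq: "sign_output (\<Sigma> S) z \<noteq> sign_output (\<Sigma> S') z" by auto
    have dim: "dim_vec (final_output (\<Sigma> S) z) = p" for S
      using \<Sigma>[of S] by (auto simp: final_output_def linear_systems_def)
    have "\<exists>i<p. sign01 (final_output (\<Sigma> S) z $ i) \<noteq> sign01 (final_output (\<Sigma> S') z $ i)"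
    proof (rule ccontr)
      assume "\<not> ?thesis"
      then have "sign_output (\<Sigma> S) z = sign_output (\<Sigma> S') z"
        unfolding sign_output_def by (intro eq_vecI) (auto simp: dim)
      then show False using neq by simp
    qed
    then obtain i where i: "i < p" "sign01 (final_output (\<Sigma> S) z $ i) \<noteq> sign01 (final_output (\<Sigma> S') z $ i)"
      by blast
    have zD: "z \<in> fst ` D" using zb(1) by force
    then have iY: "(i, \<gamma> z) \<in> Y" using i by (simp add: Y_def)
    have "cleared_output (i, \<gamma> z) (\<theta> S) > 0 \<longleftrightarrow> \<not> cleared_output (i, \<gamma> z) (\<theta> S') > 0"
      using sgn[OF iY] \<gamma>[OF zD] i(2) by (auto simp: sign01_def split: if_splits)
    then have "cleared_output (i, \<gamma> z) (\<theta> S) * cleared_output (i, \<gamma> z) (\<theta> S') < 0"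
      using nz[OF iY, of S] nz[OF iY, of S'] by (auto simp: mult_less_0_iff)
    then show ?thesis using iY by blast
  qed
  have inj: "inj_on \<theta> (Pow D)"
  proof (rule inj_onI, rule ccontr)
    fix S S' assume "S \<in> Pow D" "S' \<in> Pow D" "\<theta> S = \<theta> S'" "S \<noteq> S'"
    then show False using sep[of S S'] by (auto simp: mult_less_0_iff)
  qed
  have "card (\<theta> ` Pow D) \<le> Suc (2 * (card Y * (2 * n * k * Suc lmax + 2))) ^ card (params n m p)"
  proof (rule card_sign_cells_le[OF finite_params Y(1)])
    show "finite (\<theta> ` Pow D)" using D(1) by simp
    show "polyfun (params n m p) (2 * n * k * Suc lmax + 2) (cleared_output x)" if "x \<in> Y" for x
      using polyfun_cleared_output[OF l, of "fst x" p "snd x"] that Y(2) by auto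
    show "\<exists>x\<in>Y. cleared_output x t * cleared_output x t' < 0"
      if t: "t \<in> \<theta> ` Pow D" "t' \<in> \<theta> ` Pow D" "t \<noteq> t'" for t t'
    proof -
      obtain S S' where "S \<subseteq> D" "S' \<subseteq> D" "t = \<theta> S" "t' = \<theta> S'" using t(1,2) by auto
      then show ?thesis using sep[of S S'] t(3) by auto
    qed
  qed (use nz in auto)
  also have "\<dots> \<le> Suc (2 * ((p * card D) * (2 * n * k * Suc lmax + 2))) ^ card (params n m p)"
    using cardY by (intro power_mono Suc_le_mono[THEN iffD2] mult_left_mono mult_right_mono) auto
  also have "\<dots> \<le> Suc (2 * ((p * card D) * (2 * n * k * Suc lmax + 2))) ^ (n * n + n * m + p * n + p * n + p)"
    by (intro power_increasing card_params) simp
  finally show ?thesis by (simp add: card_image[OF inj] card_Pow D(1))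
qed

end


section \<open>Solving the inequality for the cardinality\<close>

lemma two_powr_ge: "y \<ge> 2 \<Longrightarrow> 2 * y \<le> 2 powr y" for y :: real
proof -
  assume y: "y \<ge> 2"
  define t where "t = (y - 2) * ln 2"
  have "1 / 2 \<le> ln (2::real)" using ln_le_minus_one[of "1 / 2"] by (simp add: ln_div)
  then have "(y - 2) * (1 / 2) \<le> t" unfolding t_def using y by (intro mult_left_mono) auto
  moreover have "1 + t \<le> exp t" by (rule exp_ge_add_one_self)
  moreover have "2 powr y = 4 * exp t"
    using powr_add[of 2 2 "y - 2"] by (simp add: t_def powr_def[of 2 "y - 2"])
  ultimately show ?thesis by argo
qed

lemma two_mult_square_le_pow: "2 * p ^ 2 \<le> 2 ^ p + 6 * p" for p :: nat
proof -
  have large: "2 * q ^ 2 \<le> 2 ^ q" if "q \<ge> 7" for q :: nat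
    using that
  proof (induction q rule: nat_induct_at_least)
    case (Suc q)
    have "4 * q + 2 \<le> 2 * q ^ 2"
      using Suc.hyps mult_le_mono1[of 7 q q] unfolding power2_eq_square by linarith
    then show ?case using Suc.IH by (simp add: power2_eq_square algebra_simps)
  qed simp
  show ?thesis
  proof (cases "p \<ge> 7")
    case False
    then have "p \<in> {0, 1, 2, 3, 4, 5, 6}" by auto
    then show ?thesis by auto
  qed (use large[of p] in simp)
qed

text \<open>Except for \<open>n = m = 1\<close>, the number of variables is at most two thirds of
  \<open>2 p m n\<^sup>2 + 4 n + p\<close>.\<close>

lemma parameter_count_le:
  fixes n m p :: nat
  assumes "n \<ge> 1" "m \<ge> 1" "p \<ge> 1" and "n \<ge> 2 \<or> m \<ge> 2"
  shows "3 * (n * n + n * m + p * n + p * n + p) \<le> 2 * (2 * p * m * n ^ 2 + 4 * n + p)"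
proof -
  obtain c where c: "p = c + 1" using assms(3) by (metis le_add_diff_inverse2)
  show ?thesis
  proof (cases "n \<ge> 2")
    case True
    then obtain a where a: "n = a + 2" by (metis le_add_diff_inverse2)
    obtain b where b: "m = b + 1" using assms(2) by (metis le_add_diff_inverse2)
    show ?thesis unfolding a b c by (simp add: algebra_simps power2_eq_square)
  next
    case False
    then have n: "n = 1" using assms(1) by simp
    then obtain b where b: "m = b + 2" using assms(4) False by (metis le_add_diff_inverse2)
    show ?thesis unfolding n b c by (simp add: algebra_simps)
  qed
qed

text \<open>Put \<open>d' = 2 p m n\<^sup>2 + 4 n + p\<close> and let \<open>Y\<close> be the argument of the logarithm.  If \<open>N\<close> exceeded
  \<open>2 d' log\<^sub>2 Y\<close>, then \<open>x = N / d'\<close> would satisfy \<open>2\<^sup>x\<^sup>/\<^sup>2 > Y\<close> and \<open>2\<^sup>x\<^sup>/\<^sup>2 \<ge> x\<close>.  In general the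
  number of variables is at most \<open>2 d' / 3\<close>, so that \<open>2\<^sup>3\<^sup>x\<^sup>/\<^sup>2\<close>, which exceeds \<open>Y\<^sup>2 x\<close>, would be bounded
  by a multiple of \<open>x\<close> that is at most \<open>Y\<^sup>2 x\<close>.  For \<open>n = m = 1\<close> only \<open>2\<^sup>x\<close>, which exceeds \<open>Y x\<close>, is
  bounded in this way; but then the bound is at most \<open>Y x\<close>, because the last factor of \<open>Y\<close> is at
  least \<open>2 p\<^sup>2\<close>.\<close>

lemma card_bound_imp_log_bound:
  fixes n m p k lmax N :: nat
  assumes ge1: "n \<ge> 1" "m \<ge> 1" "p \<ge> 1" "k \<ge> 1"
    and count: "2 ^ N \<le> Suc (2 * ((p * N) * (2 * n * k * Suc lmax + 2))) ^ (n * n + n * m + p * n + p * n + p)"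
  shows "real N \<le> 2 * (2 * real p * real m * real n ^ 2 + 4 * real n + real p) *
      log 2 (8 * exp 1 *
        (8 * real m * real n ^ 2 * real k * (real n + real lmax) + 1) *
        (2 ^ p - 1 + 2 * real p * (2 * real k + 1) ^ n + 2 * real n * real k))"
proof -
  define D :: real where "D = 8 * real m * real n ^ 2 * real k * (real n + real lmax) + 1"
  define d :: nat where "d = n * n + n * m + p * n + p * n + p"
  define d' :: nat where "d' = 2 * p * m * n ^ 2 + 4 * n + p"
  define s :: real where "s = 2 ^ p - 1 + 2 * real p * (2 * real k + 1) ^ n + 2 * real n * real k"
  define Y where "Y = 8 * exp 1 * D * s"
  have mn: "m * n ^ 2 \<ge> 1" using ge1 by simp
  have D_nat: "D = real (8 * (m * n ^ 2 * k * (n + lmax)) + 1)" by (simp add: D_def)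
  have deg: "real (2 * n * k * Suc lmax + 2) \<le> D"
  proof -
    have "1 * n * k * (1 + lmax) \<le> m * n ^ 2 * k * (n + lmax)"
      using ge1 by (intro mult_mono add_mono) (auto simp: power2_eq_square)
    moreover have "1 * 1 * 1 \<le> n * k * (1 + lmax)"
      using ge1 by (intro mult_mono) auto
    ultimately have "2 * n * k * Suc lmax + 2 \<le> 8 * (m * n ^ 2 * k * (n + lmax)) + 1"
      by (simp add: algebra_simps)
    then show ?thesis unfolding D_nat by (simp only: of_nat_le_iff)
  qed
  have D9: "D \<ge> 9"
  proof -
    have "1 * 1 * 1 \<le> m * n ^ 2 * k * (n + lmax)"
      using ge1 mn by (intro mult_mono) auto
    then have "9 \<le> 8 * (m * n ^ 2 * k * (n + lmax)) + 1" by simp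
    then show ?thesis unfolding D_nat by linarith
  qed
  have d'D: "real d' \<le> real p * D"
  proof -
    have "m * n ^ 2 * 1 * 1 \<le> m * n ^ 2 * k * (n + lmax)"
      using ge1 by (intro mult_mono) auto
    moreover have "4 * n \<le> p * (4 * (m * n ^ 2))"
      using ge1 mult_mono[of 1 p n "m * n ^ 2"] by (simp add: power2_eq_square)
    ultimately have "d' \<le> p * (8 * (m * n ^ 2 * k * (n + lmax)) + 1)"
      unfolding d'_def
      using mult_le_mono2[of "m * n ^ 2 * 1 * 1" "m * n ^ 2 * k * (n + lmax)" p] by (simp add: algebra_simps)
    then show ?thesis unfolding D_nat by (simp only: of_nat_le_iff flip: of_nat_mult)
  qed
  have d'1: "d' \<ge> 1" using ge1 by (simp add: d'_def)
  have pow3: "(2 * real k + 1) ^ n \<ge> 3"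
  proof -
    have "3 \<le> (2 * real k + 1) ^ 1" using ge1 by simp
    also have "\<dots> \<le> (2 * real k + 1) ^ n" using ge1 by (intro power_increasing) auto
    finally show ?thesis .
  qed
  have s: "s \<ge> 2 ^ p + 6 * real p + 1"
  proof -
    have "real p * 3 \<le> real p * (2 * real k + 1) ^ n" using pow3 by (intro mult_left_mono) auto
    moreover have "1 * 1 \<le> real n * real k" using ge1 by (intro mult_mono) auto
    ultimately show ?thesis unfolding s_def by linarith
  qed
  have sp: "s \<ge> 6 * real p" "s \<ge> 2 * real p ^ 2" "s \<ge> 1"
  proof -
    show "s \<ge> 6 * real p" using s zero_le_power[of "2::real" p] by linarith
    have "real (2 * p ^ 2) \<le> real (2 ^ p + 6 * p)" using two_mult_square_le_pow by (simp only: of_nat_le_iff)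
    then show "s \<ge> 2 * real p ^ 2" using s by simp
    show "s \<ge> 1" using s zero_le_power[of "2::real" p] by linarith
  qed
  have Y: "Y \<ge> 16 * D * s"
  proof -
    have "16 * (D * s) \<le> (8 * exp 1) * (D * s)"
      using exp_ge_add_one_self[of 1] D9 sp by (intro mult_right_mono) auto
    then show ?thesis by (simp add: Y_def mult_ac)
  qed
  have Y16: "Y \<ge> 16"
  proof -
    have "1 * 1 \<le> D * s" using D9 sp by (intro mult_mono) auto
    then show ?thesis using Y by simp
  qed
  define L where "L = log 2 Y"
  have L4: "L \<ge> 4" unfolding L_def using Y16 by (subst le_log_iff) auto
  have YL: "2 powr L = Y" unfolding L_def using Y16 by simp
  define Q where "Q = 1 + 2 * real p * real N * D"
  have Q1: "Q \<ge> 1" using D9 by (simp add: Q_def)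
  have countQ: "2 powr real N \<le> Q powr real d"
  proof -
    have "real (2 ^ N) \<le> real (Suc (2 * ((p * N) * (2 * n * k * Suc lmax + 2))) ^ d)"
      using count unfolding d_def by (simp only: of_nat_le_iff)
    also have "\<dots> = (1 + 2 * real p * real N * real (2 * n * k * Suc lmax + 2)) ^ d"
      by (simp add: algebra_simps)
    also have "\<dots> \<le> Q ^ d"
      unfolding Q_def using deg by (intro power_mono add_left_mono mult_left_mono) auto
    finally show ?thesis using Q1 by (simp add: powr_realpow)
  qed
  have "real N \<le> 2 * real d' * L"
  proof (rule ccontr)
    assume "\<not> real N \<le> 2 * real d' * L"
    then have N: "real N > 2 * real d' * L" by simp
    define x where "x = real N / real d'"
    have Nx: "real N = real d' * x" using d'1 by (simp add: x_def)
    have x: "x > 2 * L" using N d'1 unfolding x_def by (simp add: field_simps)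
    have x8: "x \<ge> 8" using x L4 by linarith
    have half: "2 powr (x / 2) \<ge> x" using two_powr_ge[of "x / 2"] x8 by simp
    have halfY: "2 powr (x / 2) > Y"
      using x powr_less_mono[of L "x / 2" 2] YL by simp
    have Qx: "Q \<le> 3 * real p * real d' * D * x"
    proof -
      have "1 \<le> real p * real d' * D * x"
        using ge1 d'1 D9 x8 by (intro mult_ge1_I) auto
      then show ?thesis unfolding Q_def Nx by (simp add: algebra_simps)
    qed
    show False
    proof (cases "n \<ge> 2 \<or> m \<ge> 2")
      case True
      have "3 * d \<le> 2 * d'" using parameter_count_le[OF ge1(1-3) True] by (simp add: d_def d'_def)
      then have "real d \<le> 2 / 3 * real d'" by linarith
      then have "2 powr real N \<le> Q powr (2 / 3 * real d')"
        using countQ Q1 by (meson order_trans powr_mono)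
      then have "(2 powr real N) powr (3 / 2 / real d') \<le> (Q powr (2 / 3 * real d')) powr (3 / 2 / real d')"
        using d'1 by (intro powr_mono2) auto
      then have "2 powr (3 / 2 * x) \<le> Q"
        using d'1 Q1 by (simp add: powr_powr x_def mult_ac)
      also have "2 powr (3 / 2 * x) = 2 powr (x / 2) * 2 powr (x / 2) * 2 powr (x / 2)"
        by (simp flip: powr_add)
      finally have "2 powr (x / 2) * 2 powr (x / 2) * 2 powr (x / 2) \<le> 3 * real p * real d' * D * x"
        using Qx by linarith
      moreover have "Y * Y * x < 2 powr (x / 2) * 2 powr (x / 2) * 2 powr (x / 2)"
        using halfY half Y16 x8 by (intro mult_less_le_imp_less mult_strict_mono) auto
      moreover have "3 * real p * real d' * D * x \<le> Y * Y * x"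
      proof -
        have "3 * real p * real d' * D \<le> 3 * real p * (real p * D) * D"
          using d'D D9 by (intro mult_right_mono mult_left_mono) auto
        also have "\<dots> \<le> (16 * D * s) * (16 * D * s)"
        proof -
          have "real p * real p \<le> s * s" using sp by (intro mult_mono) auto
          moreover have "0 \<le> s * s" by simp
          ultimately have "3 * (real p * real p) \<le> 256 * (s * s)" by linarith
          then have "3 * (real p * real p) * (D * D) \<le> 256 * (s * s) * (D * D)"
            by (intro mult_right_mono) auto
          then show ?thesis by (simp add: mult_ac)
        qed
        also have "\<dots> \<le> Y * Y" using Y Y16 D9 sp by (intro mult_mono) auto
        finally show ?thesis using x8 by (intro mult_right_mono) auto
      qed
      ultimately show False by linarith
    next
      case False
      then have nm: "n = 1" "m = 1" using ge1 by auto
      have "d \<le> d'" by (simp add: d_def d'_def nm)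
      then have "2 powr real N \<le> Q powr real d'"
        using countQ Q1 by (meson order_trans powr_mono of_nat_le_iff)
      then have "(2 powr real N) powr (1 / real d') \<le> (Q powr real d') powr (1 / real d')"
        using d'1 by (intro powr_mono2) auto
      then have "2 powr x \<le> Q"
        using d'1 Q1 by (simp add: powr_powr x_def)
      also have "2 powr x = 2 powr (x / 2) * 2 powr (x / 2)"
        by (simp flip: powr_add)
      finally have "2 powr (x / 2) * 2 powr (x / 2) \<le> 3 * real p * real d' * D * x"
        using Qx by linarith
      moreover have "Y * x < 2 powr (x / 2) * 2 powr (x / 2)"
        using halfY half Y16 x8 by (intro mult_less_le_imp_less) auto
      moreover have "3 * real p * real d' * D * x \<le> Y * x"
      proof -
        have "d' \<le> 7 * p" using ge1 by (simp add: d'_def nm)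
        then have "real d' \<le> 7 * real p" by linarith
        then have "3 * real p * real d' * D \<le> 3 * real p * (7 * real p) * D"
          using D9 by (intro mult_right_mono mult_left_mono) auto
        also have "\<dots> = 21 * real p ^ 2 * D" by (simp add: power2_eq_square)
        also have "\<dots> \<le> 16 * s * D"
          using sp(2) D9 zero_le_power2[of "real p"] by (intro mult_right_mono) linarith+
        also have "\<dots> \<le> Y" using Y by (simp add: mult_ac)
        finally show ?thesis using x8 by (intro mult_right_mono) auto
      qed
      ultimately show False by linarith
    qed
  qed
  then show ?thesis by (simp add: d'_def L_def Y_def D_def s_def)
qed


section \<open>The bound on the VC-dimension\<close>

theorem theorem3p3:
  fixes n m p k :: nat
    and \<omega> :: "nat \<Rightarrow> real \<Rightarrow> real"
    and l :: "nat \<Rightarrow> nat"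
    and \<alpha> \<beta> :: "nat \<Rightarrow> real"
  assumes "n \<ge> 1" and "m \<ge> 1" and "p \<ge> 1" and "k \<ge> 1"
    and "\<And>j. j < k \<Longrightarrow> basis_input (l j) (\<alpha> j) (\<beta> j) (\<omega> j)"
    and "lin_indep_on_unit k \<omega>"
  defines "lmax \<equiv> Max (l ` {..<k})"
  shows "ereal_of_enat (vc_sign_systems n m p k \<omega>) \<le>
    ereal (2 * (2 * real p * real m * real n ^ 2 + 4 * real n + real p) *
      log 2 (8 * exp 1 *
        (8 * real m * real n ^ 2 * real k * (real n + real lmax) + 1) *
        (2 ^ p - 1 + 2 * real p * (2 * real k + 1) ^ n + 2 * real n * real k)))"
proof -
  define bound where "bound = 2 * (2 * real p * real m * real n ^ 2 + 4 * real n + real p) *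
      log 2 (8 * exp 1 *
        (8 * real m * real n ^ 2 * real k * (real n + real lmax) + 1) *
        (2 ^ p - 1 + 2 * real p * (2 * real k + 1) ^ n + 2 * real n * real k))"
  let ?H = "loss01 ` sign_system_class n m p k \<omega>" and ?Z = "input_space m k \<omega> \<times> {0..<2 ^ p}"
  define \<mu> where "\<mu> j = Complex (\<alpha> j) (\<beta> j)" for j
  have "\<forall>j. \<exists>\<kappa>. j < k \<longrightarrow> (\<forall>t\<in>{0..1}. \<omega> j t = Re (\<kappa> * exppoly (\<mu> j) (l j) t))"
    using basis_input_exppoly[OF assms(5)] by (auto simp: \<mu>_def)
  from choice[OF this] obtain \<kappa> where
    \<kappa>: "\<forall>j. j < k \<longrightarrow> (\<forall>t\<in>{0..1}. \<omega> j t = Re (\<kappa> j * exppoly (\<mu> j) (l j) t))"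
    by (elim exE)
  have lmax: "l j \<le> lmax" if "j < k" for j
    unfolding lmax_def using that by (intro Max_ge) auto
  have finite_bound: "real (card D) \<le> bound" if "finite D" "D \<subseteq> ?Z" "shatters ?H D" for D
    unfolding bound_def
    by (rule card_bound_imp_log_bound[OF assms(1-4)],
        rule shattered_card_bound[of k \<omega> \<kappa> \<mu> l lmax]) (use \<kappa> lmax that in auto)
  have bound0: "bound \<ge> 0"
    using card_bound_imp_log_bound[OF assms(1-4), of 0 lmax] unfolding bound_def by simp
  define b where "b = nat \<lfloor>bound\<rfloor>"
  have le_b: "q \<le> b" if "real q \<le> bound" for q
    using that by (simp add: b_def le_nat_floor)
  \<comment> \<open>Subsets of shattered sets are shattered, so an infinite one would contain finite ones of any size.\<close>
  have "finite D" if D: "D \<subseteq> ?Z" "shatters ?H D" for D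
  proof (rule ccontr)
    assume "infinite D"
    then obtain D' where D': "D' \<subseteq> D" "finite D'" "card D' = Suc b"
      using infinite_arbitrarily_large by blast
    have "shatters ?H D'"
      unfolding shatters_def
    proof (intro allI impI)
      fix g :: "(real \<Rightarrow> real Matrix.vec) \<times> nat \<Rightarrow> nat" assume g: "\<forall>d\<in>D'. g d \<in> {0, 1}"
      have "\<forall>d\<in>D. (if d \<in> D' then g d else 0) \<in> {0, 1}" using g by auto
      then obtain h where "h \<in> ?H" "\<forall>d\<in>D. h d = (if d \<in> D' then g d else 0)"
        using D(2)[unfolded shatters_def, rule_format, of "\<lambda>d. if d \<in> D' then g d else 0"] by auto
      then show "\<exists>h\<in>?H. \<forall>d\<in>D'. h d = g d" using D'(1) by (intro bexI[of _ h]) auto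
    qed
    then have "card D' \<le> b" using finite_bound[OF D'(2)] D'(1) D(1) by (intro le_b) blast
    then show False using D'(3) by simp
  qed
  then have "vc_dim ?Z ?H \<le> enat b"
    unfolding vc_dim_def using finite_bound le_b by (intro SUP_least) auto
  then have "ereal_of_enat (vc_sign_systems n m p k \<omega>) \<le> ereal_of_enat (enat b)"
    unfolding vc_sign_systems_def by (simp only: ereal_of_enat_le_iff)
  also have "\<dots> \<le> ereal bound" using bound0 by (simp add: b_def)
  finally show ?thesis unfolding bound_def .
qed

end
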